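(* Let $k\ge i\ge 1$. For $n\ge0$ let $O_{k,i}(n)$ be the number of overpartitions $\lambda$ of $n$ such that (1) $f_{\overline{1}}(\lambda)+f_2(\lambda)\le i-1$; (2) $f_{\overline{2t}}(\lambda)+f_{2t}(\lambda)+f_{\overline{2t+1}}(\lambda)+f_{2t+2}(\lambda)\le k-1$ for every integer $t\ge0$; (3) for every integer $t\ge0$, if $f_{2t+1}(\lambda)\ge1$ then $f_{2t+2}(\lambda)\le k-2$. For $k>i\ge1$ let $P_{k,i}(n)$ be the number of overpartitions of $n$ whose non-overlined parts are all $\not\equiv 0,\pm(2i-1)\pmod{4k-2}$ (overlined parts unrestricted), and let $P_{k,k}(n)$ be the number of overpartitions of $n$ into parts (overlined or not) not divisible by $2k-1$. Then $O_{k,i}(n)=P_{k,i}(n)$ for all $k\ge i\ge1$ and $n\ge0$.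
   Context: An overpartition of $n$ is a partition of $n$ in which the first occurrence of each part size may be overlined (so each size occurs overlined at most once). For $t\ge1$, $f_t(\lambda)$ (resp. $f_{\overline t}(\lambda)$) denotes the number of non-overlined (resp. overlined) parts of $\lambda$ equal to $t$; by convention $f_0=f_{\overline0}=0$. *)

theory Defs
  imports "HOL-Library.Multiset" "HOL-Number_Theory.Cong"
begin

text \<open>
  An overpartition is a pair \<open>(M, S)\<close>: \<open>M\<close> is the multiset of all parts, overlined or not, and
  \<open>S\<close> is the set of part sizes whose first occurrence is overlined.
\<close>

type_synonym overpartition = "nat multiset \<times> nat set"

definition partitions :: "nat \<Rightarrow> nat multiset set" where
  "partitions n = {M. 0 \<notin># M \<and> sum_mset M = n}"

definition overpartitions :: "nat \<Rightarrow> overpartition set" where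
  "overpartitions n = {(M, S). M \<in> partitions n \<and> S \<subseteq> set_mset M}"

definition f_over :: "overpartition \<Rightarrow> nat \<Rightarrow> nat" where
  "f_over l t = (if t \<in> snd l then 1 else 0)"

definition f_non :: "overpartition \<Rightarrow> nat \<Rightarrow> nat" where
  "f_non l t = count (fst l) t - f_over l t"

text \<open>The bounds are compared in \<open>int\<close> because \<open>k - 2\<close> is negative for \<open>k = 1\<close>.\<close>

definition O_set :: "nat \<Rightarrow> nat \<Rightarrow> nat \<Rightarrow> overpartition set" where
  "O_set k i n = {l \<in> overpartitions n.
     int (f_over l 1 + f_non l 2) \<le> int i - 1 \<and>
     (\<forall>t. int (f_over l (2*t) + f_non l (2*t) + f_over l (2*t+1) + f_non l (2*t+2)) \<le> int k - 1) \<and>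
     (\<forall>t. f_non l (2*t+1) \<ge> 1 \<longrightarrow> int (f_non l (2*t+2)) \<le> int k - 2)}"

definition O_num :: "nat \<Rightarrow> nat \<Rightarrow> nat \<Rightarrow> nat" where
  "O_num k i n = card (O_set k i n)"

definition P_set :: "nat \<Rightarrow> nat \<Rightarrow> nat \<Rightarrow> overpartition set" where
  "P_set k i n =
    (if i < k then
       {l \<in> overpartitions n. \<forall>t. f_non l t \<ge> 1 \<longrightarrow>
          [int t \<noteq> 0] (mod (4 * int k - 2)) \<and>
          [int t \<noteq> 2 * int i - 1] (mod (4 * int k - 2)) \<and>
          [int t \<noteq> - (2 * int i - 1)] (mod (4 * int k - 2))}
     else
       {l \<in> overpartitions n. \<forall>t. f_non l t \<ge> 1 \<or> f_over l t \<ge> 1 \<longrightarrow>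
          \<not> (2 * int k - 1) dvd int t})"

definition P_num :: "nat \<Rightarrow> nat \<Rightarrow> nat \<Rightarrow> nat" where
  "P_num k i n = card (P_set k i n)"

lemma f_non_0 [simp]: "l \<in> overpartitions n \<Longrightarrow> f_non l 0 = 0"
  by (auto simp: overpartitions_def partitions_def f_non_def not_in_iff)

lemma f_over_0 [simp]: "l \<in> overpartitions n \<Longrightarrow> f_over l 0 = 0"
  by (auto simp: overpartitions_def partitions_def f_over_def)

lemma size_le_sum_mset: "0 \<notin># M \<Longrightarrow> size M \<le> sum_mset (M :: nat multiset)"
  by (induction M) auto

lemma finite_partitions: "finite (partitions n)"
proof (rule finite_subset)
  show "partitions n \<subseteq> mset ` {xs. set xs \<subseteq> {..n} \<and> length xs \<le> n}"
  proof
    fix M assume M: "M \<in> partitions n"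
    obtain xs where xs: "M = mset xs" by (metis ex_mset)
    have "length xs \<le> n"
      using size_le_sum_mset[of M] M xs by (simp add: partitions_def)
    moreover have "set xs \<subseteq> {..n}"
      using M xs by (auto simp: partitions_def sum_mset_sum_list intro: member_le_sum_list)
    ultimately show "M \<in> mset ` {xs. set xs \<subseteq> {..n} \<and> length xs \<le> n}"
      using xs by blast
  qed
  show "finite (mset ` {xs. set xs \<subseteq> {..n} \<and> length xs \<le> n})"
    by (intro finite_imageI finite_lists_length_le) simp
qed

lemma finite_overpartitions: "finite (overpartitions n)"
proof -
  have "overpartitions n = (SIGMA M:partitions n. Pow (set_mset M))"
    by (auto simp: overpartitions_def)
  then show ?thesis by (simp add: finite_partitions)
qed

end

theory Submission
  imports Defs "HOL-Computational_Algebra.Formal_Laurent_Series"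
begin

text \<open>
  Split an overpartition into the multiset of its non-overlined parts and the set of its overlined
  parts. Let \<open>W m i\<close> be the generating function of those satisfying the three conditions shifted by
  \<open>2m\<close>, with all parts exceeding \<open>2m\<close>. Splitting off the parts \<open>2m+1\<close> and \<open>2m+2\<close> expresses \<open>W m i\<close>
  through the series \<open>W (m+1) j\<close>. Since \<open>W m i\<close> tends to \<open>1\<close>, this recurrence has only one solution.
  Write \<open>x = q^(2m)\<close> and \<open>p = q^2\<close>. An explicit solution is
  \<open>C_i(x) = sum_n (A_n p^(-in) - B_n x^i p^(i(n+1)))\<close>; solving the recurrence termwise, so that the
  \<open>B\<close>-terms at \<open>x\<close> match the \<open>A\<close>-terms at \<open>xp\<close> and the \<open>A\<close>-terms at \<open>x\<close> match the \<open>B\<close>-terms at \<open>xp\<close>,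
  determines \<open>A_n\<close> and \<open>B_n\<close>. At \<open>x = 1\<close> the sum is
  \<open>prod_t (1+q^t)/(1-q^t)\<close> times a theta series, which the Jacobi triple product turns into the
  product counting the overpartitions on the other side. For \<open>i = k\<close> the factor
  \<open>prod_j (1-q^((2k-1)(2j+1)))\<close> equals \<open>prod_s (1+q^((2k-1)s))^(-1)\<close> by Euler's identity, which
  also removes the overlined multiples of \<open>2k-1\<close>.

  No infinite sum or product occurs: infinite products are cut off at a large bound \<open>M\<close>, series at
  \<open>L\<close>, and all identities hold in the field of Laurent series up to terms of high order.
\<close>

subsection \<open>Order of vanishing of Laurent series\<close>

text \<open>Plays the role of \<open>f = O(q^N)\<close>. Stated through coefficients so that it also
  covers \<open>f = 0\<close>; \<open>N\<close> may be negative because Laurent series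
  occur.\<close>

definition ord_ge :: "int \<Rightarrow> 'a::field fls \<Rightarrow> bool" where
  "ord_ge N f \<longleftrightarrow> (\<forall>n<N. fls_nth f n = 0)"

text \<open>Closure under sums is read off the coefficients; closure under products needs this form,
  since subdegrees add over a field.\<close>

lemma ord_ge_iff: "ord_ge N f \<longleftrightarrow> f = 0 \<or> N \<le> fls_subdegree f"
  unfolding ord_ge_def
proof
  assume "\<forall>n<N. fls_nth f n = 0"
  then show "f = 0 \<or> N \<le> fls_subdegree f"
    by (metis fls_subdegree_geI)
qed auto

lemma ord_ge_0 [simp]: "ord_ge N 0"
  by (simp add: ord_ge_def)

lemma ord_ge_mono: "ord_ge N f \<Longrightarrow> M \<le> N \<Longrightarrow> ord_ge M f"
  by (auto simp: ord_ge_def)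

lemma ord_ge_add: "ord_ge N f \<Longrightarrow> ord_ge N g \<Longrightarrow> ord_ge N (f + g)"
  by (simp add: ord_ge_def)

lemma ord_ge_diff: "ord_ge N f \<Longrightarrow> ord_ge N g \<Longrightarrow> ord_ge N (f - g)"
  by (simp add: ord_ge_def)

lemma ord_ge_minus [simp]: "ord_ge N (- f) \<longleftrightarrow> ord_ge N f"
  by (simp add: ord_ge_def)

lemma ord_ge_sum: "(\<And>x. x \<in> A \<Longrightarrow> ord_ge N (f x)) \<Longrightarrow> ord_ge N (sum f A)"
  by (induction A rule: infinite_finite_induct) (auto intro: ord_ge_add)

lemma ord_ge_mult: "ord_ge N f \<Longrightarrow> ord_ge M g \<Longrightarrow> ord_ge (N + M) (f * g)"
  by (cases "f = 0"; cases "g = 0") (auto simp: ord_ge_iff)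

lemma ord_ge_mult_right: "ord_ge N f \<Longrightarrow> ord_ge 0 g \<Longrightarrow> ord_ge N (f * g)"
  using ord_ge_mult[of N f 0 g] by simp

lemma ord_ge_mult_left: "ord_ge 0 f \<Longrightarrow> ord_ge N g \<Longrightarrow> ord_ge N (f * g)"
  using ord_ge_mult[of 0 f N g] by simp

lemma ord_ge_1 [simp]: "ord_ge 0 1"
  by (simp add: ord_ge_def)

lemma ord_ge_fps [simp]: "ord_ge 0 (fps_to_fls f)"
  by (simp add: ord_ge_def)

lemma ord_ge_neg_one_power [simp]: "ord_ge 0 ((-1) ^ n)"
  by (cases "even n") (simp_all add: ord_ge_def)

text \<open>For \<open>N \<ge> 1\<close> these series form a multiplicative group, so quotients of
  cut-off products are estimated by closure properties alone.\<close>

abbreviation near1 :: "int \<Rightarrow> 'a::field fls \<Rightarrow> bool" where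
  "near1 N f \<equiv> ord_ge N (f - 1)"

lemma near1_imp_ord_ge: "near1 N f \<Longrightarrow> 1 \<le> N \<Longrightarrow> ord_ge 0 f"
  using ord_ge_add[of 0 "f - 1" 1] ord_ge_mono[of N "f - 1" 0] by simp

lemma near1_nonzero: "near1 N f \<Longrightarrow> 1 \<le> N \<Longrightarrow> f \<noteq> 0"
  by (auto simp: ord_ge_def dest: spec[of _ 0])

lemma near1_mult:
  assumes "near1 N f" "near1 N g" "1 \<le> N"
  shows "near1 N (f * g)"
proof -
  have "f * g - 1 = (f - 1) * g + (g - 1)"
    by (simp add: algebra_simps)
  then show ?thesis
    using ord_ge_add ord_ge_mult_right near1_imp_ord_ge assms by metis
qed

text \<open>Such an \<open>f\<close> has constant term 1 and no negative powers, so
  \<open>1/f\<close> has order 0, and \<open>1/f - 1 = -(f - 1)/f\<close>.\<close>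

lemma near1_inverse:
  assumes "near1 N f" "1 \<le> N"
  shows "near1 N (inverse f)"
proof -
  have f: "f \<noteq> 0"
    using assms near1_nonzero by auto
  have "fls_nth (f - 1) n = 0" if "n < 1" for n
    using assms that by (auto simp: ord_ge_def)
  from this[of 0] this have "fls_subdegree f = 0"
    by (intro fls_subdegree_eqI) (auto split: if_splits)
  then have "ord_ge 0 (inverse f)"
    using f by (simp add: ord_ge_iff)
  moreover have "inverse f - 1 = - ((f - 1) * inverse f)"
    using f by (simp add: algebra_simps)
  ultimately show ?thesis
    using assms ord_ge_mult_right by (metis ord_ge_minus)
qed

lemma near1_divide: "near1 N f \<Longrightarrow> near1 N g \<Longrightarrow> 1 \<le> N \<Longrightarrow> near1 N (f / g)"
  unfolding divide_inverse by (intro near1_mult near1_inverse)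

lemma near1_prod:
  "(\<And>x. x \<in> A \<Longrightarrow> near1 N (f x)) \<Longrightarrow> 1 \<le> N \<Longrightarrow> near1 N (prod f A)"
  by (induction A rule: infinite_finite_induct) (auto intro: near1_mult)

section \<open>The variable \<open>q\<close> and the factors \<open>1 + q^n\<close>,
  \<open>1 - q^n\<close>\<close>

definition q :: "rat fls" where "q = fls_X"

lemma q_nonzero [simp]: "q \<noteq> 0"
  by (simp add: q_def)

lemma ord_ge_q_powi: "N \<le> n \<Longrightarrow> ord_ge N (q powi n)"
  by (simp add: ord_ge_iff q_def)

lemma ord_ge_q_power: "N \<le> int n \<Longrightarrow> ord_ge N (q ^ n)"
  using ord_ge_q_powi[of N "int n"] by simp

lemma near1_1_plus: "N \<le> int n \<Longrightarrow> near1 N (1 + q ^ n)"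
  by (simp add: ord_ge_q_power)

lemma near1_1_minus: "N \<le> int n \<Longrightarrow> near1 N (1 - q ^ n)"
  by (simp add: ord_ge_q_power)

lemma one_plus_q_nonzero [simp]: "0 < n \<Longrightarrow> 1 + q ^ n \<noteq> 0"
  by (rule near1_nonzero[OF near1_1_plus[of 1]]) auto

lemma one_minus_q_nonzero [simp]: "0 < n \<Longrightarrow> 1 - q ^ n \<noteq> 0"
  by (rule near1_nonzero[OF near1_1_minus[of 1]]) auto

subsection \<open>The explicit solution of the recurrence\<close>

text \<open>
  \<open>over_prod M / over_prod s\<close> and \<open>odd_prod m / odd_prod M\<close> replace the infinite products
  \<open>prod_(j > 2s) (1+q^j) / prod_(t > s) (1-q^(2t))\<close> and \<open>prod_(t >= m) (1-q^(2t+1))^(-1)\<close>.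
  As quotients they satisfy the functional equations of the infinite products exactly, also for \<open>s > M\<close>.
\<close>

definition over_prod :: "nat \<Rightarrow> rat fls" where
  "over_prod s = (\<Prod>t<s. (1 + q ^ (2*t+1)) * (1 + q ^ (2*t+2)) / (1 - q ^ (2*t+2)))"

definition odd_prod :: "nat \<Rightarrow> rat fls" where
  "odd_prod s = (\<Prod>t<s. 1 - q ^ (2*t+1))"

lemma near1_over_prod: "near1 1 (over_prod s)"
  unfolding over_prod_def by (intro near1_prod near1_mult near1_divide near1_1_plus
      near1_1_minus) auto

lemma near1_odd_prod: "near1 1 (odd_prod s)"
  unfolding odd_prod_def by (intro near1_prod near1_1_minus) auto

lemma over_prod_nonzero [simp]: "over_prod s \<noteq> 0" and odd_prod_nonzero [simp]: "odd_prod s \<noteq> 0"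
  using near1_nonzero[OF near1_over_prod] near1_nonzero[OF near1_odd_prod] by auto

lemma over_prod_0: "over_prod 0 = 1"
  by (simp add: over_prod_def)

lemma over_prod_Suc: "over_prod (Suc s) = over_prod s * ((1 + q ^ (2*s+1)) * (1 + q ^ (2*s+2)) /
    (1 - q ^ (2*s+2)))"
  by (simp add: over_prod_def)

lemma odd_prod_Suc: "odd_prod (Suc s) = odd_prod s * (1 - q ^ (2*s+1))"
  by (simp add: odd_prod_def)

text \<open>With \<open>x = q^(2m)\<close> and \<open>p = q^2\<close>, this is the exponent of
  \<open>x^(kn) p^(kn(n+1)) q^(-n^2)\<close>.\<close>

definition coeffA_exp :: "nat \<Rightarrow> nat \<Rightarrow> nat \<Rightarrow> int" where
  "coeffA_exp k m n = 2 * int k * int n * (int n + 1) - int n * int n + 2 * int k * int m * int n"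

text \<open>In the limit of large \<open>M\<close> the last factor is
  \<open>(-q;q)_(2n) / (q^2;q^2)_n\<close> times
  \<open>(-x q^(2n+1);q)_inf / ((x q^(2n+2);q^2)_inf (xq;q^2)_inf)\<close>.\<close>

definition coeffA :: "nat \<Rightarrow> nat \<Rightarrow> nat \<Rightarrow> nat \<Rightarrow> rat fls" where
  "coeffA k M m n = (-1) ^ n * q powi coeffA_exp k m n * (over_prod n / over_prod (m + n) *
      (over_prod M * odd_prod m / odd_prod M))"

text \<open>The ratio of \<open>B_n\<close> to \<open>A_n\<close> is the one for which
  \<open>C_0 + C_1/q\<close> vanishes term by term.\<close>

definition coeffB :: "nat \<Rightarrow> nat \<Rightarrow> nat \<Rightarrow> nat \<Rightarrow> rat fls" where
  "coeffB k M m n = coeffA k M m n * (1 + q powi (- 1 - 2 * int n)) / (1 + q ^ (2*(m+n)+1))"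

text \<open>The index \<open>i\<close> is an integer: the recurrence is also used where it produces
  the indices 0 and -1.\<close>

definition gordon_term :: "nat \<Rightarrow> nat \<Rightarrow> nat \<Rightarrow> nat \<Rightarrow> int \<Rightarrow> rat fls" where
  "gordon_term k M m n i = coeffA k M m n * q powi (- 2 * i * int n)
     - coeffB k M m n * q powi (2 * i * (int m + int n + 1))"

definition gordon_sum :: "nat \<Rightarrow> nat \<Rightarrow> nat \<Rightarrow> nat \<Rightarrow> int \<Rightarrow> rat fls" where
  "gordon_sum k M L m i = (\<Sum>n\<le>L. gordon_term k M m n i)"

text \<open>The \<open>B\<close>-terms at \<open>x\<close> against the \<open>A\<close>-terms at
  \<open>xp\<close>. Raising \<open>m\<close> adds one factor to \<open>odd_prod m\<close> and one
  to \<open>over_prod (m + n)\<close>, while \<open>x^(kn)\<close> gains \<open>p^(kn)\<close>,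
  which \<open>q powi (- 2 * int k * int n)\<close> cancels.\<close>

lemma coeffA_shift:
  "(1 - q ^ (2*m+1)) * (1 - q ^ (2*(m+n)+2)) * coeffB k M m n =
   coeffA k M (Suc m) n * q powi (- 2 * int k * int n) * (1 + q powi (- 1 - 2 * int n)) * (1 + q
       ^ (2*(m+n)+2))"
proof -
  have e: "q powi coeffA_exp k (Suc m) n * q powi (- 2 * int k * int n) = q powi coeffA_exp k m n"
    by (subst power_int_add [symmetric]) (auto simp: coeffA_exp_def algebra_simps)
  have "coeffA k M (Suc m) n * q powi (- 2 * int k * int n) =
    (-1) ^ n * (q powi coeffA_exp k (Suc m) n * q powi (- 2 * int k * int n)) *
      (over_prod n / over_prod (Suc m + n) * (over_prod M * odd_prod (Suc m) / odd_prod M))"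
    by (simp add: coeffA_def)
  also have "\<dots> = (-1) ^ n * q powi coeffA_exp k m n * (over_prod n / over_prod (Suc (m + n)) *
      (over_prod M * odd_prod (Suc m) / odd_prod M))"
    unfolding e by simp
  also have "\<dots> = coeffA k M m n * (1 - q ^ (2*m+1)) * (1 - q ^ (2*(m+n)+2)) / ((1 + q ^
      (2*(m+n)+1)) * (1 + q ^ (2*(m+n)+2)))"
    unfolding coeffA_def over_prod_Suc odd_prod_Suc by (simp add: field_simps del: power_Suc)
  finally have *: "coeffA k M (Suc m) n * q powi (- 2 * int k * int n) = \<dots>" .
  have h: "a * b * (c * e / p) = c * a * b / (p * r) * e * r" if "p \<noteq> 0" "r \<noteq> 0" for a b c e p r
      :: "rat fls"
    using that by (simp add: field_simps)
  show ?thesis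
    unfolding * coeffB_def by (intro h one_plus_q_nonzero) simp_all
qed

text \<open>The \<open>A\<close>-terms at \<open>x\<close> against the \<open>B\<close>-terms at
  \<open>xp\<close>. As \<open>Suc m + n = m + Suc n\<close>, the quotient by
  \<open>over_prod (m + n)\<close> is the same on both sides; only \<open>over_prod n\<close>,
  \<open>odd_prod m\<close>, the sign and the monomial change.\<close>

lemma coeffA_Suc:
  "(1 - q ^ (2*m+1)) * (1 - q ^ (2*n+2)) * coeffA k M m (Suc n) =
   - (coeffB k M (Suc m) n * q powi (2 * int k * int m + 2 * int k * (int n + 2)) *
     (1 + q ^ (2*(m+n)+3)) * (1 + q ^ (2*n+2)))"
proof -
  \<comment> \<open>The factor \<open>1 + q^(2n+1)\<close> gained by
    \<open>over_prod (Suc n)\<close> equals \<open>q^(2n+1)\<close> times the factor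
    \<open>1 + q^(-1-2n)\<close> of \<open>coeffB\<close>.\<close>
  have e: "q powi coeffA_exp k (Suc m) n * (1 + q powi (- 1 - 2 * int n)) * q powi (2 * int k *
      int m + 2 * int k * (int n + 2))
     = q powi coeffA_exp k m (Suc n) * (1 + q ^ (2*n+1))"
  proof -
    have "q powi coeffA_exp k (Suc m) n * q powi (2 * int k * int m + 2 * int k * (int n + 2))
       = q powi coeffA_exp k m (Suc n) * q powi int (2*n+1)"
      by (subst power_int_add [symmetric], simp)+ (auto simp: coeffA_exp_def algebra_simps)
    moreover have "q powi int (2*n+1) * q powi (- 1 - 2 * int n) = 1"
      by (subst power_int_add [symmetric]) auto
    moreover have "x * (1 + v) * y = z * (1 + w)" if "x * y = z * w" "w * v = 1" for v w x y z
        :: "rat fls"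
    proof -
      have "x * (1 + v) * y = x * y + (x * y) * v"
        by (simp add: algebra_simps)
      also have "\<dots> = z * w + z * (w * v)"
        unfolding that(1) by (simp add: mult_ac)
      finally show ?thesis
        unfolding that(2) by (simp add: algebra_simps)
    qed
    ultimately show ?thesis
      unfolding power_int_of_nat by blast
  qed
  have "coeffB k M (Suc m) n * q powi (2 * int k * int m + 2 * int k * (int n + 2)) * (1 + q ^
      (2*(m+n)+3))
    = (-1) ^ n * (over_prod n / over_prod (Suc m + n) * (over_prod M * odd_prod (Suc m) /
        odd_prod M)) *
      (q powi coeffA_exp k (Suc m) n * (1 + q powi (- 1 - 2 * int n)) * q powi (2 * int k * int
          m + 2 * int k * (int n + 2)))"
  proof -
    have "2 * (Suc m + n) + 1 = 2 * (m + n) + 3" by simp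
    then have "coeffB k M (Suc m) n = coeffA k M (Suc m) n * (1 + q powi (- 1 - 2 * int n)) / (1
        + q ^ (2*(m+n)+3))"
      unfolding coeffB_def by metis
    then have "coeffB k M (Suc m) n * (1 + q ^ (2*(m+n)+3)) = coeffA k M (Suc m) n * (1 + q powi
        (- 1 - 2 * int n))"
      by simp
    moreover have "b * y * p = a * v * y" if "b * p = a * v" for a b v y p :: "rat fls"
    proof -
      have "b * y * p = b * p * y"
        by (simp only: mult_ac)
      then show ?thesis
        unfolding that .
    qed
    ultimately have h: "coeffB k M (Suc m) n * y * (1 + q ^ (2*(m+n)+3)) =
        coeffA k M (Suc m) n * (1 + q powi (- 1 - 2 * int n)) * y" for y
      by blast
    show ?thesis
      unfolding h unfolding coeffA_def by (simp only: mult_ac)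
  qed
  also have "\<dots> = (-1) ^ n * (over_prod n / over_prod (Suc m + n) * (over_prod M * odd_prod (Suc
      m) / odd_prod M)) *
       (q powi coeffA_exp k m (Suc n) * (1 + q ^ (2*n+1)))"
    unfolding e ..
  finally have 1: "coeffB k M (Suc m) n * q powi (2 * int k * int m + 2 * int k * (int n + 2)) *
      (1 + q ^ (2*(m+n)+3)) = \<dots>" .
  have h: "d * (c * (a * b / d)) = c * a * b" if "d \<noteq> 0" for a b c d :: "rat fls"
    using that by simp
  have 2: "(1 - q ^ (2*n+2)) * over_prod (Suc n) = over_prod n * (1 + q ^ (2*n+1)) * (1 + q ^
      (2*n+2))"
    unfolding over_prod_Suc by (intro h one_minus_q_nonzero) simp
  have 3: "a * b * (- s * e * (x / y * (c * d / f))) = - (s * e * (b * x / y * (c * (d * a) / f)))"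
    for a b c d e f s x y :: "rat fls"
    by simp
  have "(1 - q ^ (2*m+1)) * (1 - q ^ (2*n+2)) * coeffA k M m (Suc n) =
     - ((-1) ^ n * q powi coeffA_exp k m (Suc n) *
       ((1 - q ^ (2*n+2)) * over_prod (Suc n) / over_prod (Suc m + n) * (over_prod M * odd_prod
           (Suc m) / odd_prod M)))"
    unfolding coeffA_def odd_prod_Suc 3 [symmetric] by simp
  then show ?thesis
    unfolding 1 2 by (simp only: mult_ac times_divide_eq_right times_divide_eq_left
        divide_divide_eq_left)
qed

text \<open>
  With \<open>U_j = C_j + C_(j+1)/q\<close> the recurrence reads
  \<open>(1-xq)(C_i - C_(i-1)) = (xp)^(i-1) (U_(k-i+1) + xp U_(k-i))\<close>, the right-hand side taken at \<open>xp\<close>.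
  It holds for every integer \<open>i\<close>; the boundary cases \<open>i = 1\<close> and \<open>i = k\<close> of the combinatorial
  recurrence follow from \<open>U_0 = 0\<close> and \<open>U_1 = -xp U_(-1)\<close>.
\<close>

definition gordon_pair :: "nat \<Rightarrow> nat \<Rightarrow> nat \<Rightarrow> nat \<Rightarrow> int \<Rightarrow> rat fls" where
  "gordon_pair k M L m j = gordon_sum k M L m j + q powi (- 1) * gordon_sum k M L m (j + 1)"

text \<open>Both sides break up into the same two families: the difference
  \<open>C_i - C_(i-1)\<close> gives \<open>PA n + PB n\<close>, the side at \<open>xp\<close> gives
  \<open>PB n + PA (n+1)\<close>. After summation only \<open>PA (L+1)\<close> survives, which is
  the exact truncation error.\<close>

lemma gordon_sum_recurrence:
  fixes i :: int
  shows "q powi ((2 * int m + 2) * (i - 1)) *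
      (gordon_pair k M L (Suc m) (int k - i + 1) + q ^ (2*m+2) * gordon_pair k M L (Suc m) (int
          k - i))
    - (1 - q ^ (2*m+1)) * (gordon_sum k M L m i - gordon_sum k M L m (i - 1))
   = (1 - q ^ (2*m+1)) * (1 - q ^ (2*L+2)) * coeffA k M m (Suc L) * q powi (- 2 * i * (int L + 1))"
proof -
  define PA where "PA n = (1 - q ^ (2*m+1)) * (1 - q ^ (2*n)) * coeffA k M m n * q powi (- 2 * i
      * int n)" for n
  define PB where "PB n = (1 - q ^ (2*m+1)) * (1 - q ^ (2*(m+n)+2)) * coeffB k M m n
      * q powi (2 * (i - 1) * (int m + int n + 1))" for n
  define z where "z = q powi ((2 * int m + 2) * (i - 1))"
  have P: "q powi a * q powi b = q powi (a + b)" for a b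
    by (simp add: power_int_add)
  have NP: "q ^ a = q powi int a" for a
    by simp
  have lhs: "(1 - q ^ (2*m+1)) * (gordon_sum k M L m i - gordon_sum k M L m (i - 1)) = (\<Sum>n\<le>L. PA
      n + PB n)"
  proof -
    have "(1 - q ^ (2*m+1)) * (gordon_term k M m n i - gordon_term k M m n (i - 1)) = PA n + PB
        n" for n
    proof -
      have a: "q powi (- 2 * i * int n) - q powi (- 2 * (i - 1) * int n) = (1 - q ^ (2*n)) * q
          powi (- 2 * i * int n)"
        unfolding left_diff_distrib NP P by (simp add: algebra_simps)
      have b: "q powi (2 * (i - 1) * (int m + int n + 1)) - q powi (2 * i * (int m + int n + 1)) =
          (1 - q ^ (2*(m+n)+2)) * q powi (2 * (i - 1) * (int m + int n + 1))"
        unfolding left_diff_distrib NP P by (simp add: algebra_simps)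
      have "gordon_term k M m n i - gordon_term k M m n (i - 1) =
         coeffA k M m n * (q powi (- 2 * i * int n) - q powi (- 2 * (i - 1) * int n)) +
         coeffB k M m n * (q powi (2 * (i - 1) * (int m + int n + 1)) - q powi (2 * i * (int m +
             int n + 1)))"
        unfolding gordon_term_def by (simp only: right_diff_distrib) simp
      then show ?thesis
        unfolding a b PA_def PB_def by (simp only: distrib_left mult_ac)
    qed
    then show ?thesis
      unfolding gordon_sum_def by (simp add: sum_subtractf [symmetric] sum_distrib_left)
  qed
  have rhs: "z * (gordon_pair k M L (Suc m) (int k - i + 1) + q ^ (2*m+2) * gordon_pair k M L
      (Suc m) (int k - i))
     = (\<Sum>n\<le>L. PB n + PA (Suc n))"
  proof -
    have "z * (gordon_term k M (Suc m) n (int k - i + 1) + q powi (- 1) * gordon_term k M (Suc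
        m) n (int k - i + 1 + 1)
        + q ^ (2*m+2) * (gordon_term k M (Suc m) n (int k - i) + q powi (- 1) * gordon_term k M
            (Suc m) n (int k - i + 1)))
       = PB n + PA (Suc n)" for n
    proof -
      have a: "z * (q powi (- 2 * (int k - i + 1) * int n) + q powi (- 1) * q powi (- 2 * (int k
          - i + 1 + 1) * int n)
        + q ^ (2*m+2) * (q powi (- 2 * (int k - i) * int n) + q powi (- 1) * q powi (- 2 * (int
            k - i + 1) * int n)))
       = q powi (- 2 * int k * int n) * (1 + q powi (- 1 - 2 * int n)) * (1 + q ^ (2*(m+n)+2))
          * q powi (2 * (i - 1) * (int m + int n + 1))"
        unfolding z_def distrib_left distrib_right mult_1_left mult_1_right NP P mult.assoc
        by (simp add: algebra_simps)
      have b: "z * (q powi (2 * (int k - i + 1) * (int (Suc m) + int n + 1))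
          + q powi (- 1) * q powi (2 * (int k - i + 1 + 1) * (int (Suc m) + int n + 1))
        + q ^ (2*m+2) * (q powi (2 * (int k - i) * (int (Suc m) + int n + 1))
          + q powi (- 1) * q powi (2 * (int k - i + 1) * (int (Suc m) + int n + 1))))
       = q powi (2 * int k * int m + 2 * int k * (int n + 2)) *
     (1 + q ^ (2*(m+n)+3)) * (1 + q ^ (2*n+2)) * q powi (- 2 * i * int (Suc n))"
        unfolding z_def distrib_left distrib_right mult_1_left mult_1_right NP P mult.assoc
        by (simp add: algebra_simps)
      have "z * (gordon_term k M (Suc m) n (int k - i + 1) + q powi (- 1) * gordon_term k M (Suc
          m) n (int k - i + 1 + 1)
        + q ^ (2*m+2) * (gordon_term k M (Suc m) n (int k - i) + q powi (- 1) * gordon_term k M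
            (Suc m) n (int k - i + 1)))
        = coeffA k M (Suc m) n * (z * (q powi (- 2 * (int k - i + 1) * int n) + q powi (- 1) * q
            powi (- 2 * (int k - i + 1 + 1) * int n)
        + q ^ (2*m+2) * (q powi (- 2 * (int k - i) * int n) + q powi (- 1) * q powi (- 2 * (int
            k - i + 1) * int n))))
        - coeffB k M (Suc m) n * (z * (q powi (2 * (int k - i + 1) * (int (Suc m) + int n + 1))
          + q powi (- 1) * q powi (2 * (int k - i + 1 + 1) * (int (Suc m) + int n + 1))
        + q ^ (2*m+2) * (q powi (2 * (int k - i) * (int (Suc m) + int n + 1))
          + q powi (- 1) * q powi (2 * (int k - i + 1) * (int (Suc m) + int n + 1)))))"
        unfolding gordon_term_def by (simp only: distrib_left right_diff_distrib mult_ac) simp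
      also have "\<dots> = (1 - q ^ (2*m+1)) * (1 - q ^ (2*(m+n)+2)) * coeffB k M m n * q powi (2 * (i
          - 1) * (int m + int n + 1))
         + (1 - q ^ (2*m+1)) * (1 - q ^ (2*n+2)) * coeffA k M m (Suc n) * q powi (- 2 * i * int
             (Suc n))"
        unfolding a b coeffA_shift coeffA_Suc by (simp add: mult_ac)
      finally show ?thesis
        unfolding PA_def PB_def by simp
    qed
    then show ?thesis
      unfolding gordon_pair_def gordon_sum_def by (simp only: sum.distrib [symmetric]
          sum_distrib_left)
  qed
  \<comment> \<open>The shift loses nothing at the lower end because \<open>PA 0\<close> contains
    \<open>1 - q^0\<close>.\<close>
  have "(\<Sum>n\<le>L. PA (Suc n)) = (\<Sum>n\<le>L. PA n) + PA (Suc L)"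
  proof -
    have "PA 0 = 0" by (simp add: PA_def)
    then show ?thesis
      using sum.atMost_Suc_shift[of PA L] by simp
  qed
  then have "z * (gordon_pair k M L (Suc m) (int k - i + 1) + q ^ (2*m+2) * gordon_pair k M L
      (Suc m) (int k - i))
    - (1 - q ^ (2*m+1)) * (gordon_sum k M L m i - gordon_sum k M L m (i - 1)) = PA (Suc L)"
    unfolding lhs rhs sum.distrib by simp
  also have "PA (Suc L) = (1 - q ^ (2*m+1)) * (1 - q ^ (2*L+2)) * coeffA k M m (Suc L) * q powi
      (- 2 * i * (int L + 1))"
    unfolding PA_def by (simp add: algebra_simps)
  finally show ?thesis unfolding z_def .
qed

text \<open>Already true for each \<open>n\<close>, by the choice of \<open>coeffB\<close>; hence it
  is exact for every cut-off \<open>L\<close>.\<close>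

lemma gordon_pair_zero: "gordon_pair k M L m 0 = 0"
proof -
  have "gordon_term k M m n 0 + q powi (- 1) * gordon_term k M m n 1 = 0" for n
  proof -
    have "gordon_term k M m n 0 + q powi (- 1) * gordon_term k M m n 1 =
      coeffA k M m n * (1 + q powi (- 1) * q powi (- 2 * int n)) - coeffB k M m n * (1 + q powi
          (- 1) * q powi (2 * (int m + int n + 1)))"
      by (simp add: gordon_term_def algebra_simps)
    also have "q powi (- 1) * q powi (- 2 * int n) = q powi (- 1 - 2 * int n)"
      by (subst power_int_add [symmetric]) auto
    also have "q powi (- 1) * q powi (2 * (int m + int n + 1)) = q powi int (2*(m+n)+1)"
      by (subst power_int_add [symmetric]) (auto simp: algebra_simps)
    also have "coeffB k M m n * (1 + q powi int (2*(m+n)+1)) = coeffA k M m n * (1 + q powi (- 1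
        - 2 * int n))"
      unfolding coeffB_def power_int_of_nat using one_plus_q_nonzero[of "2*(m+n)+1"] by simp
    finally show ?thesis by simp
  qed
  then show ?thesis
    unfolding gordon_pair_def gordon_sum_def by (simp only: sum.distrib [symmetric]
        sum_distrib_left add_0) simp
qed

text \<open>The \<open>n\<close>-th term of \<open>U_j\<close> is \<open>A_n (1 + q^(-1-2n))\<close>
  times \<open>q^(-2jn) - q^(2j(m+n+1))\<close>, and this bracket is antisymmetric under
  \<open>j -> -j\<close> up to the factor \<open>q^(2j(m+1))\<close>.\<close>

lemma gordon_pair_reflect: "gordon_pair k M L m 1 = - (q ^ (2*m+2) * gordon_pair k M L m (-1))"
proof -
  have P: "q powi a * q powi b = q powi (a + b)" for a b
    by (simp add: power_int_add)
  have NP: "q ^ a = q powi int a" for a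
    by simp
  have t: "gordon_term k M m n j + q powi (- 1) * gordon_term k M m n (j + 1) =
      coeffA k M m n * (1 + q powi (- 1 - 2 * int n)) * (q powi (- 2 * j * int n) - q powi (2 *
          j * (int m + int n + 1)))" for n j
  proof -
    have "coeffB k M m n * (1 + q ^ (2*(m+n)+1)) = coeffA k M m n * (1 + q powi (- 1 - 2 * int n))"
      unfolding coeffB_def using one_plus_q_nonzero[of "2*(m+n)+1"] by simp
    moreover have "gordon_term k M m n j + q powi (- 1) * gordon_term k M m n (j + 1) =
        coeffA k M m n * ((1 + q powi (- 1 - 2 * int n)) * q powi (- 2 * j * int n))
        - coeffB k M m n * ((1 + q ^ (2*(m+n)+1)) * q powi (2 * j * (int m + int n + 1)))"
    proof -
      have a: "q powi (- 2 * j * int n) + q powi (- 1) * q powi (- 2 * (j + 1) * int n) =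
         (1 + q powi (- 1 - 2 * int n)) * q powi (- 2 * j * int n)"
        unfolding distrib_right mult_1_left P by (simp add: algebra_simps)
      have b: "q powi (2 * j * (int m + int n + 1)) + q powi (- 1) * q powi (2 * (j + 1) * (int
          m + int n + 1)) =
         (1 + q ^ (2*(m+n)+1)) * q powi (2 * j * (int m + int n + 1))"
        unfolding distrib_right mult_1_left NP P by (simp add: algebra_simps)
      show ?thesis
        unfolding a [symmetric] b [symmetric] gordon_term_def by (simp only: distrib_left
            right_diff_distrib mult_ac) simp
    qed
    ultimately show ?thesis
      by (simp only: mult.assoc [symmetric] right_diff_distrib)
  qed
  have "gordon_term k M m n 1 + q powi (- 1) * gordon_term k M m n (1 + 1) =
     - (q ^ (2*m+2) * (gordon_term k M m n (-1) + q powi (- 1) * gordon_term k M m n (-1 + 1)))"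
         for n
  proof -
    have "q powi (- 2 * 1 * int n) - q powi (2 * 1 * (int m + int n + 1)) =
       - (q ^ (2*m+2) * (q powi (- 2 * (- 1) * int n) - q powi (2 * (- 1) * (int m + int n + 1))))"
      unfolding right_diff_distrib NP P by (simp add: algebra_simps)
    then show ?thesis
      unfolding t by (simp only: mult_ac mult_minus_right)
  qed
  then have "(\<Sum>n\<le>L. gordon_term k M m n 1 + q powi (- 1) * gordon_term k M m n (1 + 1)) =
     (\<Sum>n\<le>L. - (q ^ (2*m+2) * (gordon_term k M m n (-1) + q powi (- 1) * gordon_term k M m n (-1
         + 1))))"
    by simp
  then show ?thesis
    unfolding gordon_pair_def gordon_sum_def sum_negf sum_distrib_left [symmetric] sum.distrib .
qed

section \<open>Orders of the coefficients and the recurrence up to high order\<close>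

lemma ord_ge_coeffA: "ord_ge (coeffA_exp k m n) (coeffA k M m n)"
proof -
  have "near1 1 (over_prod n / over_prod (m + n) * (over_prod M * odd_prod m / odd_prod M))"
    by (intro near1_mult near1_divide near1_over_prod near1_odd_prod) auto
  then have "ord_ge 0 (over_prod n / over_prod (m + n) * (over_prod M * odd_prod m / odd_prod M))"
    by (rule near1_imp_ord_ge) simp
  then have "ord_ge (0 + coeffA_exp k m n + 0) (coeffA k M m n)"
    unfolding coeffA_def by (intro ord_ge_mult ord_ge_neg_one_power ord_ge_q_powi) auto
  then show ?thesis by simp
qed

lemma ord_ge_coeffB: "ord_ge (coeffA_exp k m n - 1 - 2 * int n) (coeffB k M m n)"
proof -
  have "near1 1 (inverse (1 + q ^ (2*(m+n)+1)))"
    by (intro near1_inverse near1_1_plus) auto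
  then have "ord_ge 0 (inverse (1 + q ^ (2*(m+n)+1)))"
    by (rule near1_imp_ord_ge) simp
  moreover have "ord_ge (- 1 - 2 * int n) (1 + q powi (- 1 - 2 * int n))"
    by (intro ord_ge_add ord_ge_q_powi ord_ge_mono[OF ord_ge_1]) auto
  ultimately have "ord_ge (coeffA_exp k m n + (- 1 - 2 * int n) + 0) (coeffB k M m n)"
    unfolding coeffB_def divide_inverse by (intro ord_ge_mult ord_ge_coeffA)
  then show ?thesis by (simp add: algebra_simps)
qed

text \<open>With \<open>l = L + 1\<close> the order of the truncation error is at least
  \<open>l^2 - 2l\<close>: the quadratic part contributes \<open>l^2\<close>, and
  \<open>i \<le> k + 1\<close> costs at most \<open>2l\<close>. The case \<open>i = k + 1\<close> is
  used in the next boundary argument.\<close>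

lemma gordon_sum_recurrence_approx:
  fixes i :: int
  assumes "1 \<le> k" "i \<le> int k + 1"
  shows "ord_ge (int L - 1) (q powi ((2 * int m + 2) * (i - 1)) *
      (gordon_pair k M L (Suc m) (int k - i + 1) + q ^ (2*m+2) * gordon_pair k M L (Suc m) (int
          k - i))
    - (1 - q ^ (2*m+1)) * (gordon_sum k M L m i - gordon_sum k M L m (i - 1)))"
proof -
  define l where "l = int L + 1"
  have l: "l \<ge> 1" by (simp add: l_def)
  have "coeffA_exp k m (Suc L) = 2 * (int k * l * l) + 2 * (int k * l) - l * l + 2 * (int k *
      int m * l)"
    by (simp add: coeffA_exp_def l_def algebra_simps)
  moreover have "i * l \<le> int k * l + l"
    using mult_right_mono[OF assms(2), of l] l by (simp add: algebra_simps)
  moreover have "l * l \<le> int k * l * l"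
    using mult_right_mono[of 1 "int k" "l * l"] assms l by (simp add: mult.assoc)
  moreover have "0 \<le> int k * int m * l" using l by simp
  \<comment> \<open>This turns \<open>l^2 - 2l\<close> into the linear bound
    \<open>l - 2 = L - 1\<close>.\<close>
  moreover have "3 * l \<le> l * l + 2"
  proof -
    have "0 \<le> (l - 1) * (l - 2)"
      using l by (cases "l = 1") auto
    then show ?thesis by (simp add: algebra_simps)
  qed
  moreover have "- 2 * i * l = - 2 * (i * l)" "int L = l - 1"
    by (auto simp: l_def)
  ultimately have e: "int L - 1 \<le> coeffA_exp k m (Suc L) + (- 2 * i * l)"
    by linarith
  have "near1 1 ((1 - q ^ (2*m+1)) * (1 - q ^ (2*L+2)))"
    by (intro near1_mult near1_1_minus) auto
  then have "ord_ge 0 ((1 - q ^ (2*m+1)) * (1 - q ^ (2*L+2)))"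
    by (rule near1_imp_ord_ge) simp
  then have "ord_ge (0 + coeffA_exp k m (Suc L) + (- 2 * i * l))
     ((1 - q ^ (2*m+1)) * (1 - q ^ (2*L+2)) * coeffA k M m (Suc L) * q powi (- 2 * i * l))"
    by (intro ord_ge_mult ord_ge_coeffA ord_ge_q_powi) auto
  then show ?thesis
    unfolding gordon_sum_recurrence using e unfolding l_def by (auto elim: ord_ge_mono)
qed

lemma gordon_sum_zero: "gordon_sum k M L m 0 = - (q powi (- 1) * gordon_sum k M L m 1)"
  using gordon_pair_zero[of k M L m] by (simp add: gordon_pair_def eq_neg_iff_add_eq_0)

lemma ord_ge_divide_near1: "ord_ge N f \<Longrightarrow> near1 1 g \<Longrightarrow> ord_ge N (f / g)"
  unfolding divide_inverse
  by (intro ord_ge_mult_right near1_imp_ord_ge[of 1] near1_inverse) auto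

text \<open>At \<open>i = 1\<close> the recurrence involves \<open>C_(k+1)\<close>, which has no
  combinatorial meaning. It is eliminated with the instances \<open>k + 1\<close> and
  \<open>k\<close> one level further (\<open>e2\<close> and \<open>e3\<close>), whose right-hand
  sides cancel in the right combination because \<open>U_0 = 0\<close> and \<open>U_1\<close> is a
  multiple of \<open>U_(-1)\<close>.\<close>

lemma gordon_sum_one_approx:
  assumes k: "1 \<le> k"
  shows "ord_ge (int L - 1) ((1 - q ^ (2*m+1)) * gordon_sum k M L m 1 -
    (gordon_sum k M L (Suc m) (int k) + q ^ (2*m+2) * gordon_sum k M L (Suc m) (int k - 1)))"
proof -
  define e1 where "e1 = q powi ((2 * int m + 2) * (1 - 1)) *
      (gordon_pair k M L (Suc m) (int k - 1 + 1) + q ^ (2*m+2) * gordon_pair k M L (Suc m) (int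
          k - 1))
    - (1 - q ^ (2*m+1)) * (gordon_sum k M L m 1 - gordon_sum k M L m (1 - 1))"
  define e2 where "e2 = q powi ((2 * int (Suc m) + 2) * (int k + 1 - 1)) *
      (gordon_pair k M L (Suc (Suc m)) (int k - (int k + 1) + 1) + q ^ (2*Suc m+2) * gordon_pair
          k M L (Suc (Suc m)) (int k - (int k + 1)))
    - (1 - q ^ (2*Suc m+1)) * (gordon_sum k M L (Suc m) (int k + 1) - gordon_sum k M L (Suc m)
        (int k + 1 - 1))"
  define e3 where "e3 = q powi ((2 * int (Suc m) + 2) * (int k - 1)) *
      (gordon_pair k M L (Suc (Suc m)) (int k - int k + 1) + q ^ (2*Suc m+2) * gordon_pair k M L
          (Suc (Suc m)) (int k - int k))
    - (1 - q ^ (2*Suc m+1)) * (gordon_sum k M L (Suc m) (int k) - gordon_sum k M L (Suc m) (int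
        k - 1))"
  have v: "ord_ge (int L - 1) e1" "ord_ge (int L - 1) e2" "ord_ge (int L - 1) e3"
    unfolding e1_def e2_def e3_def using k by (intro gordon_sum_recurrence_approx; simp)+
  \<comment> \<open>Up to the factor \<open>1/q\<close>, this is the difference between
    \<open>U_k + xp U_(k-1)\<close> and \<open>(1 + 1/q) (C_k + xp C_(k-1))\<close>, all taken at
    \<open>xp\<close>.\<close>
  define D where "D = gordon_sum k M L (Suc m) (int k + 1) - gordon_sum k M L (Suc m) (int k)
    + q ^ (2*m+2) * (gordon_sum k M L (Suc m) (int k) - gordon_sum k M L (Suc m) (int k - 1))"
  define u where "u = gordon_pair k M L (Suc (Suc m)) (-1)"
  have P: "q powi a * q powi b = q powi (a + b)" for a b
    by (simp add: power_int_add)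
  have NP: "q ^ a = q powi int a" for a
    by simp
  have w: "q powi ((2 * int (Suc m) + 2) * int k) * q ^ (2 * Suc m + 2) =
      q ^ (2*m+2) * (q powi ((2 * int (Suc m) + 2) * (int k - 1)) * q ^ (2 * Suc (Suc m) + 2))"
    unfolding NP P by (simp add: algebra_simps)
  have "e2 = q powi ((2 * int (Suc m) + 2) * int k) * q ^ (2 * Suc m + 2) * u
      - (1 - q ^ (2*Suc m+1)) * (gordon_sum k M L (Suc m) (int k + 1) - gordon_sum k M L (Suc m)
          (int k))"
    unfolding e2_def u_def by (simp add: gordon_pair_zero)
  moreover have "e3 = - (q powi ((2 * int (Suc m) + 2) * (int k - 1)) * q ^ (2 * Suc (Suc m) +
      2) * u)
      - (1 - q ^ (2*Suc m+1)) * (gordon_sum k M L (Suc m) (int k) - gordon_sum k M L (Suc m)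
          (int k - 1))"
    unfolding e3_def u_def by (simp add: gordon_pair_zero gordon_pair_reflect)
  ultimately have "e2 + q ^ (2*m+2) * e3 = - ((1 - q ^ (2*Suc m+1)) * D)"
    unfolding w D_def by (simp only: right_diff_distrib distrib_left mult_minus_right mult_ac) simp
  then have D: "D = - (e2 + q ^ (2*m+2) * e3) / (1 - q ^ (2*Suc m+1))"
    using one_minus_q_nonzero[of "2*Suc m+1"] by simp
  have vD: "ord_ge (int L - 1) D"
    unfolding D using v
    by (intro ord_ge_divide_near1 near1_1_minus ord_ge_minus[THEN iffD2] ord_ge_add
        ord_ge_mult_left ord_ge_q_power) auto
  have "(1 + q powi (- 1)) * ((1 - q ^ (2*m+1)) * gordon_sum k M L m 1 -
    (gordon_sum k M L (Suc m) (int k) + q ^ (2*m+2) * gordon_sum k M L (Suc m) (int k - 1))) = q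
        powi (- 1) * D - e1"
    unfolding e1_def D_def gordon_pair_def by (simp add: gordon_sum_zero algebra_simps)
  \<comment> \<open>\<open>1 + 1/q\<close> has order -1; multiplied by \<open>q\<close> it becomes
    the unit \<open>1 + q\<close>, and dividing by that loses no order.\<close>
  then have "q * (1 + q powi (- 1)) * ((1 - q ^ (2*m+1)) * gordon_sum k M L m 1 -
    (gordon_sum k M L (Suc m) (int k) + q ^ (2*m+2) * gordon_sum k M L (Suc m) (int k - 1))) = q
        * (q powi (- 1) * D - e1)"
    by (simp only: mult.assoc)
  also have "\<dots> = D - q * e1"
    by (simp add: algebra_simps)
  also have "q * (1 + q powi (- 1)) = 1 + q ^ 1"
    by (simp add: algebra_simps)
  finally have "(1 - q ^ (2*m+1)) * gordon_sum k M L m 1 -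
    (gordon_sum k M L (Suc m) (int k) + q ^ (2*m+2) * gordon_sum k M L (Suc m) (int k - 1)) = (D
        - q ^ 1 * e1) / (1 + q ^ 1)"
    using one_plus_q_nonzero[of 1] by (simp add: field_simps del: power_one_right)
  also have "ord_ge (int L - 1) \<dots>"
    using v vD by (intro ord_ge_divide_near1 near1_1_plus ord_ge_diff ord_ge_mult_left
        ord_ge_q_power) auto
  finally show ?thesis .
qed

text \<open>Mirrors \<open>restr_step\<close>, but with the factor \<open>1 / (1 - q^(2m+1))\<close>
  for every \<open>b\<close>. The two shapes are reconciled at \<open>b = k - 1\<close> in
  \<open>restr_step_approx\<close>.\<close>

definition gordon_step :: "nat \<Rightarrow> nat \<Rightarrow> nat \<Rightarrow> nat \<Rightarrow> nat \<Rightarrow> rat fls" where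
  "gordon_step k M L m b = q ^ ((2*m+2)*b) *
     (gordon_sum k M L (Suc m) (int k - int b) + q ^ (2*m+2) * gordon_sum k M L (Suc m) (int k -
         int b - 1)) / (1 - q ^ (2*m+1))"

text \<open>Summing the recurrence for \<open>C_(j+1) - C_j\<close> from \<open>C_1\<close> upwards.
  The two halves of each \<open>U_j\<close> give the two sums, which correspond to the absence and
  the presence of an overlined part \<open>2m+1\<close>.\<close>

lemma gordon_sum_sum_approx:
  assumes k: "1 \<le> k"
  shows "Suc i \<le> k \<Longrightarrow> ord_ge (int L - 1) (gordon_sum k M L m (int (Suc i)) -
     ((\<Sum>b<Suc i. gordon_step k M L m b) + q ^ (2*m+1) * (\<Sum>b<i. gordon_step k M L m b)))"
proof (induction i)
  case 0
  have "ord_ge (int L - 1) (((1 - q ^ (2*m+1)) * gordon_sum k M L m 1 -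
    (gordon_sum k M L (Suc m) (int k) + q ^ (2*m+2) * gordon_sum k M L (Suc m) (int k - 1))) /
        (1 - q ^ (2*m+1)))"
    by (intro ord_ge_divide_near1 near1_1_minus gordon_sum_one_approx k) auto
  then show ?case
    using one_minus_q_nonzero[of "2*m+1"]
    by (simp add: gordon_step_def diff_divide_distrib del: one_minus_q_nonzero)
next
  case (Suc i)
  define j where "j = int (Suc (Suc i))"
  have j: "j - 1 = int (Suc i)" "j \<le> int k + 1"
    "gordon_sum k M L (Suc m) (int k - j + 1) = gordon_sum k M L (Suc m) (int k - int (Suc i))"
    "gordon_sum k M L (Suc m) (int k - j + 1 + 1) = gordon_sum k M L (Suc m) (int k - int i)"
    "gordon_sum k M L (Suc m) (int k - j) = gordon_sum k M L (Suc m) (int k - int (Suc i) - 1)"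
    using Suc.prems by (auto simp: j_def algebra_simps)
  have z: "q powi ((2 * int m + 2) * int (Suc i)) = q ^ ((2*m+2) * Suc i)"
    by (subst power_int_of_nat [symmetric]) (simp add: algebra_simps)
  have "ord_ge (int L - 1) ((q ^ ((2*m+2) * Suc i) *
      (gordon_sum k M L (Suc m) (int k - int (Suc i)) + q powi (-1) * gordon_sum k M L (Suc m)
          (int k - int i)
       + q ^ (2*m+2) * (gordon_sum k M L (Suc m) (int k - int (Suc i) - 1) + q powi (-1) *
           gordon_sum k M L (Suc m) (int k - int (Suc i))))
    - (1 - q ^ (2*m+1)) * (gordon_sum k M L m j - gordon_sum k M L m (int (Suc i)))) / (1 - q ^
        (2*m+1)))"
    by (intro ord_ge_divide_near1 near1_1_minus
        gordon_sum_recurrence_approx[OF k j(2), of L m M, unfolded gordon_pair_def j(1,3-5) z]) auto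
  also have "(q ^ ((2*m+2) * Suc i) *
      (gordon_sum k M L (Suc m) (int k - int (Suc i)) + q powi (-1) * gordon_sum k M L (Suc m)
          (int k - int i)
       + q ^ (2*m+2) * (gordon_sum k M L (Suc m) (int k - int (Suc i) - 1) + q powi (-1) *
           gordon_sum k M L (Suc m) (int k - int (Suc i))))
    - (1 - q ^ (2*m+1)) * (gordon_sum k M L m j - gordon_sum k M L m (int (Suc i)))) / (1 - q ^
        (2*m+1))
    = gordon_step k M L m (Suc i) + q ^ (2*m+1) * gordon_step k M L m i - (gordon_sum k M L m j
        - gordon_sum k M L m (int (Suc i)))"
  proof -
    \<comment> \<open>The factor \<open>1/q\<close> in \<open>U_j\<close> trades one part
      \<open>2m+2\<close> for one part \<open>2m+1\<close>.\<close>
    have a: "q ^ ((2*m+2) * Suc i) * q powi (-1) = q ^ (2*m+1) * q ^ ((2*m+2)*i)"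
      by (simp add: power_add field_simps)
    have h: "(y * (c1 + v * c2 + x * (c3 + v * c4)) - d * e) / d =
       y * (c1 + x * c3) / d + w * (z * (c2 + x * c4) / d) - e"
      if "y * v = w * z" "d \<noteq> 0" for c1 c2 c3 c4 d e v w x y z :: "rat fls"
    proof -
      have "(y * (c1 + v * c2 + x * (c3 + v * c4)) - d * e) / d =
        (y * (c1 + x * c3) + (y * v) * (c2 + x * c4)) / d - e"
        using that(2) by (simp add: field_simps)
      then show ?thesis
        unfolding that(1) by (simp add: add_divide_distrib mult.assoc)
    qed
    have d: "int k - int i - 1 = int k - int (Suc i)"
      by simp
    show ?thesis
      unfolding gordon_step_def d by (intro h[OF a] one_minus_q_nonzero) simp
  qed
  finally have "ord_ge (int L - 1) (gordon_step k M L m (Suc i) + q ^ (2*m+1) * gordon_step k M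
      L m i - (gordon_sum k M L m j - gordon_sum k M L m (int (Suc i))))" .
  from ord_ge_diff[OF Suc.IH this] Suc.prems show ?case
    by (simp add: j_def algebra_simps)
qed

text \<open>At \<open>m = M\<close> the \<open>A\<close>-term with \<open>n = 0\<close> is exactly
  1. The other \<open>A\<close>-terms are small because of \<open>2kMn\<close> in the exponent, the
  \<open>B\<close>-terms because \<open>2i(M+n+1)\<close> outweighs the loss of
  \<open>2n+1\<close>.\<close>

lemma gordon_sum_base:
  assumes "1 \<le> i" "i \<le> k"
  shows "near1 (int M) (gordon_sum k M L M (int i))"
proof -
  have e: "coeffA_exp k M n - 2 * int i * int n \<ge> (if n = 0 then 0 else int M)" for n
  proof -
    have "int i * int n \<le> int k * int n"
      using assms by (intro mult_right_mono) auto
    moreover have "int n * int n \<le> int k * int n * int n"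
      using mult_right_mono[of 1 "int k" "int n * int n"] assms by (simp add: mult.assoc)
    moreover have "n \<noteq> 0 \<Longrightarrow> int M \<le> int k * int M * int n"
      using mult_mono[of 1 "int k * int n" "int M" "int M"] mult_mono[of 1 "int k" 1 "int n"] assms
      by (simp add: mult_ac)
    moreover have "0 \<le> int k * int M * int n" "0 \<le> int n * int n" by auto
    moreover have "coeffA_exp k M n = 2 * (int k * int n * int n) + 2 * (int k * int n) - int n
        * int n
        + 2 * (int k * int M * int n)"
      by (simp add: coeffA_exp_def algebra_simps)
    moreover have "2 * int i * int n = 2 * (int i * int n)" by simp
    ultimately have "0 \<le> coeffA_exp k M n - 2 * int i * int n"
      "n \<noteq> 0 \<Longrightarrow> int M \<le> coeffA_exp k M n - 2 * int i * int n"
      by linarith+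
    then show ?thesis by (cases "n = 0") auto
  qed
  have A: "ord_ge (int M) (coeffA k M M n * q powi (- 2 * int i * int n) - (if n = 0 then 1 else
      0))" for n
  proof (cases "n = 0")
    case False
    have "ord_ge (coeffA_exp k M n + (- 2 * int i * int n)) (coeffA k M M n * q powi (- 2 * int
        i * int n))"
      by (intro ord_ge_mult ord_ge_coeffA ord_ge_q_powi) auto
    then show ?thesis using e[of n] False by (auto elim: ord_ge_mono)
  qed (simp add: coeffA_def coeffA_exp_def over_prod_0)
  have B: "ord_ge (int M) (coeffB k M M n * q powi (2 * int i * (int M + int n + 1)))" for n
  proof -
    have "ord_ge (coeffA_exp k M n - 1 - 2 * int n + 2 * int i * (int M + int n + 1)) (coeffB k
        M M n * q powi (2 * int i * (int M + int n + 1)))"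
      by (intro ord_ge_mult ord_ge_coeffB ord_ge_q_powi) auto
    moreover have "int M \<le> coeffA_exp k M n - 1 - 2 * int n + 2 * int i * (int M + int n + 1)"
    proof -
      define w where "w = int i * (int M + int n + 1)"
      have "int M + int n + 1 \<le> w"
        using mult_right_mono[of 1 "int i" "int M + int n + 1"] assms by (simp add: w_def)
      moreover have "0 \<le> coeffA_exp k M n"
      proof -
        have "0 \<le> coeffA_exp k M n - 2 * int i * int n"
          using e[of n] by (auto split: if_splits)
        moreover have "0 \<le> 2 * int i * int n" by simp
        ultimately show ?thesis by linarith
      qed
      moreover have "2 * int i * (int M + int n + 1) = 2 * w"
        by (simp add: w_def)
      ultimately show ?thesis by linarith
    qed
    ultimately show ?thesis by (auto elim: ord_ge_mono)
  qed
  have "gordon_sum k M L M (int i) - 1 = (\<Sum>n\<le>L. gordon_term k M M n (int i)) - (\<Sum>n\<le>L. if n = 0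
      then 1 else 0)"
    unfolding gordon_sum_def by simp
  also have "\<dots> = (\<Sum>n\<le>L. (coeffA k M M n * q powi (- 2 * int i * int n) - (if n = 0 then 1 else 0))
      - coeffB k M M n * q powi (2 * int i * (int M + int n + 1)))"
    unfolding sum_subtractf [symmetric] gordon_term_def by (intro sum.cong) auto
  also have "ord_ge (int M) \<dots>"
    by (intro ord_ge_sum ord_ge_diff A B)
  finally show ?thesis .
qed

text \<open>At \<open>x = 1\<close> the \<open>over_prod\<close> factors depending on
  \<open>n\<close> cancel and \<open>B_n\<close> is \<open>A_n q^(-1-2n)\<close>. What remains is a
  bilateral theta series, with the indices \<open>-n\<close> and \<open>n + 1\<close> put
  together.\<close>

lemma gordon_sum_at_0:
  "gordon_sum k M L 0 i = over_prod M / odd_prod M * (\<Sum>n\<le>L. (-1) ^ n *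
     (q powi ((2 * int k - 1) * int n * int n + 2 * (int k - i) * int n)
      - q powi ((2 * int k - 1) * (int n + 1) * (int n + 1) - 2 * (int k - i) * (int n + 1))))"
proof -
  have "gordon_term k M 0 n i = over_prod M / odd_prod M * ((-1) ^ n *
     (q powi ((2 * int k - 1) * int n * int n + 2 * (int k - i) * int n)
      - q powi ((2 * int k - 1) * (int n + 1) * (int n + 1) - 2 * (int k - i) * (int n + 1))))"
          for n
  proof -
    have P: "q powi a * q powi b = q powi (a + b)" for a b
      by (simp add: power_int_add)
    have A: "coeffA k M 0 n = over_prod M / odd_prod M * (-1) ^ n * q powi coeffA_exp k 0 n"
      by (simp add: coeffA_def odd_prod_def)
    have "1 + q powi (- 1 - 2 * int n) = q powi (- 1 - 2 * int n) * (1 + q ^ (2*n+1))"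
    proof -
      have "q powi (- 1 - 2 * int n) * q powi int (2*n+1) = 1"
        unfolding P by simp
      then show ?thesis unfolding power_int_of_nat by (simp add: distrib_left)
    qed
    then have "coeffB k M 0 n = coeffA k M 0 n * q powi (- 1 - 2 * int n)"
      unfolding coeffB_def using one_plus_q_nonzero[of "2*n+1"] by simp
    then have B: "coeffB k M 0 n = over_prod M / odd_prod M * (-1) ^ n * (q powi coeffA_exp k 0
        n * q powi (- 1 - 2 * int n))"
      unfolding A by (simp only: mult.assoc)
    show ?thesis
      unfolding gordon_term_def B unfolding A mult.assoc P right_diff_distrib
      by (simp add: coeffA_exp_def algebra_simps)
  qed
  then show ?thesis
    unfolding gordon_sum_def by (simp only: sum_distrib_left)
qed

subsection \<open>The Jacobi triple product\<close>

text \<open>The base of these Gaussian binomials is \<open>v^2\<close>, so that \<open>v^(s(s-1))\<close> avoids halving exponents.\<close>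

definition qfact :: "'a::field \<Rightarrow> nat \<Rightarrow> 'a" where
  "qfact v n = (\<Prod>j<n. 1 - v ^ (2 * Suc j))"

text \<open>The Gaussian binomial only for \<open>s \<le> n\<close>; beyond that, truncated
  subtraction gives a value other than the expected 0.\<close>

definition qbinom :: "'a::field \<Rightarrow> nat \<Rightarrow> nat \<Rightarrow> 'a" where
  "qbinom v n s = qfact v n / (qfact v s * qfact v (n - s))"

lemma qfact_Suc: "qfact v (Suc n) = qfact v n * (1 - v ^ (2 * Suc n))"
  by (simp add: qfact_def)

lemma qfact_nonzero: "(\<And>j. j > 0 \<Longrightarrow> v ^ (2 * j) \<noteq> 1) \<Longrightarrow> qfact v n \<noteq> 0"
  by (auto simp: qfact_def simp del: power_Suc mult_Suc_right)

text \<open>Rests on \<open>1 - v^(2(n+1)) = v^(2(s+1)) (1 - v^(2(n-s))) + (1 -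
  v^(2(s+1)))\<close>.\<close>

lemma qbinom_Pascal:
  assumes nz: "\<And>j. j > 0 \<Longrightarrow> v ^ (2 * j) \<noteq> (1 :: 'a::field)" and "s < n"
  shows "qbinom v (Suc n) (Suc s) = v ^ (2 * Suc s) * qbinom v n (Suc s) + qbinom v n s"
proof -
  obtain d where n: "n = Suc (s + d)"
    using less_imp_Suc_add[OF \<open>s < n\<close>] by auto
  have e: "1 - v ^ (2 * Suc n) = v ^ (2 * Suc s) * (1 - v ^ (2 * Suc d)) + (1 - v ^ (2 * Suc s))"
    by (simp add: n algebra_simps flip: power_add)
  have h: "F * (a * x + b) / (S * b * (D * x)) = a * (F / (S * b * D)) + F / (S * (D * x))"
    if "b \<noteq> 0" "x \<noteq> 0" "S \<noteq> 0" "D \<noteq> 0" for F a x b S D :: 'a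
    using that by (simp add: field_simps)
  have nz': "1 - v ^ (2 * Suc j) \<noteq> 0" for j
    using nz[of "Suc j"] by simp
  have "qbinom v (Suc n) (Suc s) = qfact v n * (v ^ (2 * Suc s) * (1 - v ^ (2 * Suc d)) + (1 - v
      ^ (2 * Suc s))) /
      (qfact v s * (1 - v ^ (2 * Suc s)) * (qfact v d * (1 - v ^ (2 * Suc d))))"
  proof -
    have "Suc n - Suc s = Suc d" by (simp add: n)
    then show ?thesis
      unfolding qbinom_def by (simp only: qfact_Suc e)
  qed
  also have "\<dots> = v ^ (2 * Suc s) * (qfact v n / (qfact v s * (1 - v ^ (2 * Suc s)) * qfact v d))
      + qfact v n / (qfact v s * (qfact v d * (1 - v ^ (2 * Suc d))))"
    by (intro h nz' qfact_nonzero nz)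
  also have "\<dots> = v ^ (2 * Suc s) * qbinom v n (Suc s) + qbinom v n s"
  proof -
    have "n - Suc s = d" "n - s = Suc d" by (simp_all add: n)
    then show ?thesis
      unfolding qbinom_def by (simp only: qfact_Suc)
  qed
  finally show ?thesis .
qed

text \<open>The factor \<open>1 + y\<close> at \<open>j = 0\<close> is split off; the remaining
  product is the one for \<open>n\<close> factors at \<open>y v^2\<close>, so the induction leaves
  \<open>y\<close> arbitrary. Comparing powers of \<open>y\<close> is then Pascal's rule.\<close>

lemma q_binomial_theorem:
  fixes v y :: "'a::field"
  assumes nz: "\<And>j. j > 0 \<Longrightarrow> v ^ (2 * j) \<noteq> 1"
  shows "(\<Prod>j<n. 1 + y * v ^ (2 * j)) = (\<Sum>s\<le>n. v ^ (s * (s - 1)) * qbinom v n s * y ^ s)"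
proof (induction n arbitrary: y)
  case 0
  show ?case by (simp add: qbinom_def qfact_def)
next
  case (Suc n)
  define c where "c s = v ^ (s * (s - 1)) * qbinom v n s * v ^ (2 * s)" for s
  \<comment> \<open>Extension by 0 has to be explicit, since \<open>qbinom v n (Suc n)\<close> is
    not 0.\<close>
  define a where "a s = (if s \<le> n then c s else 0)" for s
  define t where "t s = v ^ (s * (s - 1)) * qbinom v (Suc n) s" for s
  have qbinom_refl: "qbinom v n n = 1" "qbinom v n 0 = 1" for n
    using qfact_nonzero[of v n] nz by (simp_all add: qbinom_def) (simp_all add: qfact_def)
  have "a (Suc s) + c s = t (Suc s)" if "s \<le> n" for s
  proof -
    have e: "v ^ (Suc s * (Suc s - 1)) = v ^ (s * (s - 1)) * v ^ (2 * s)"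
    proof -
      have "Suc s * (Suc s - 1) = s * (s - 1) + 2 * s"
        by (cases s) auto
      then show ?thesis by (simp only: power_add)
    qed
    show ?thesis
    proof (cases "s < n")
      case True
      have p: "qbinom v (Suc n) (Suc s) = v ^ (2 * Suc s) * qbinom v n (Suc s) + qbinom v n s"
        by (rule qbinom_Pascal) (use nz True in auto)
      have "a (Suc s) = v ^ (Suc s * (Suc s - 1)) * qbinom v n (Suc s) * v ^ (2 * Suc s)"
        using True by (simp add: a_def c_def)
      then show ?thesis
        unfolding t_def c_def p e by (simp only: distrib_left mult_ac)
    next
      case False
      then have "s = n" using that by simp
      then show ?thesis
        unfolding t_def a_def c_def using e by (simp add: qbinom_refl)
    qed
  qed
  then have step: "(\<Sum>s\<le>n. t (Suc s) * y ^ Suc s) = (\<Sum>s\<le>n. a (Suc s) * y ^ Suc s) + (\<Sum>s\<le>n. c s *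
      y ^ Suc s)"
    unfolding sum.distrib [symmetric] distrib_right [symmetric] by (intro sum.cong refl) simp
  have "(\<Prod>j<Suc n. 1 + y * v ^ (2 * j)) = (1 + y) * (\<Prod>j<n. 1 + (y * v\<^sup>2) * v ^ (2 * j))"
    by (subst prod.lessThan_Suc_shift) (simp add: mult.assoc power2_eq_square)
  also have "\<dots> = (1 + y) * (\<Sum>s\<le>n. c s * y ^ s)"
    unfolding Suc.IH c_def by (simp add: power_mult_distrib mult_ac flip: power_mult)
  also have "\<dots> = (\<Sum>s\<le>n. c s * y ^ s) + (\<Sum>s\<le>n. c s * y ^ Suc s)"
    by (simp add: sum_distrib_left sum.distrib [symmetric] algebra_simps)
  also have "(\<Sum>s\<le>n. c s * y ^ s) = (\<Sum>s\<le>Suc n. a s * y ^ s)"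
    by (simp add: a_def)
  also have "\<dots> = a 0 * y ^ 0 + (\<Sum>s\<le>n. a (Suc s) * y ^ Suc s)"
    by (rule sum.atMost_Suc_shift)
  also have "a 0 * y ^ 0 = t 0 * y ^ 0"
    by (simp add: a_def t_def c_def qbinom_refl)
  also have "t 0 * y ^ 0 + (\<Sum>s\<le>n. a (Suc s) * y ^ Suc s) + (\<Sum>s\<le>n. c s * y ^ Suc s) = (\<Sum>s\<le>Suc n.
      t s * y ^ s)"
    unfolding sum.atMost_Suc_shift[of _ n] step by (simp add: add.assoc)
  finally show ?case by (simp add: t_def)
qed

text \<open>The q-binomial theorem with \<open>2N\<close> factors in base \<open>q^(2r)\<close>,
  starting at the negative exponent \<open>c - 2rN\<close>: the second half of the factors is one
  family of the product, the first half, read backwards, the other.\<close>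

lemma finite_Jacobi_triple:
  fixes r c N :: nat
  assumes "r \<ge> 1" "c \<le> r"
  shows "(\<Prod>j<N. (1 - q ^ (c + 2*r*j)) * (1 - q ^ (2*r*(j+1) - c))) =
    (\<Sum>s\<le>2*N. (-1) ^ (N + s) * qbinom (q ^ r) (2*N) s *
       q powi (int r * (int s - int N) * (int s - int N - 1) + int c * (int s - int N)))"
proof -
  define e where "e = int c - 2 * int r * int N"
  have P: "q powi a * q powi b = q powi (a + b)" for a b
    by (simp add: power_int_add)
  have NP: "q ^ a = q powi int a" for a
    by simp
  have pp: "(q powi a) ^ b = q powi (a * int b)" for a b
    by (simp add: power_int_power')
  have nz: "(q ^ r) ^ (2 * j) \<noteq> 1" if "j > 0" for j
    using one_minus_q_nonzero[of "r * (2 * j)"] that assms by (simp add: power_mult)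
  have "(\<Prod>j<2*N. 1 + (- (q powi e)) * (q ^ r) ^ (2 * j)) =
    (\<Sum>s\<le>2*N. (q ^ r) ^ (s * (s - 1)) * qbinom (q ^ r) (2*N) s * (- (q powi e)) ^ s)"
    by (rule q_binomial_theorem) (rule nz)
  also have "(\<Prod>j<2*N. 1 + (- (q powi e)) * (q ^ r) ^ (2 * j)) = (\<Prod>j<2*N. 1 - q powi (e + 2 * int
      r * int j))"
  proof (intro prod.cong refl)
    fix j
    have "(q ^ r) ^ (2 * j) = q powi (2 * int r * int j)"
    proof -
      have "(q ^ r) ^ (2 * j) = q powi int (r * (2 * j))"
        by (simp only: power_int_of_nat power_mult)
      then show ?thesis by (simp add: mult_ac)
    qed
    then show "1 + (- (q powi e)) * (q ^ r) ^ (2 * j) = 1 - q powi (e + 2 * int r * int j)"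
      by (simp add: P)
  qed
  also have "\<dots> = (\<Prod>j<N. 1 - q powi (e + 2 * int r * int j)) * (\<Prod>j<N. 1 - q powi (e + 2 * int r *
      int (j + N)))"
  proof -
    have "{..<2*N} = {..<N} \<union> {N..<2*N}" by auto
    moreover have "prod g {N..<2*N} = (\<Prod>j<N. g (j + N))" for g :: "nat \<Rightarrow> rat fls"
      using prod.shift_bounds_nat_ivl[of g 0 N N] by (simp add: lessThan_atLeast0 mult_2)
    ultimately show ?thesis
      by (simp add: prod.union_disjoint ivl_disj_int)
  qed
  also have "(\<Prod>j<N. 1 - q powi (e + 2 * int r * int (j + N))) = (\<Prod>j<N. 1 - q ^ (c + 2*r*j))"
    unfolding NP by (intro prod.cong refl) (simp add: e_def algebra_simps)
  also have "(\<Prod>j<N. 1 - q powi (e + 2 * int r * int j)) = (\<Prod>j<N. 1 - q powi (int c - 2 * int r *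
      (int j + 1)))"
  proof -
    have "(\<Prod>j<N. 1 - q powi (e + 2 * int r * int j)) = (\<Prod>j<N. 1 - q powi (e + 2 * int r * int (N
        - Suc j)))"
      by (rule prod.nat_diff_reindex [symmetric])
    also have "\<dots> = (\<Prod>j<N. 1 - q powi (int c - 2 * int r * (int j + 1)))"
      by (intro prod.cong refl) (simp add: e_def of_nat_diff algebra_simps)
    finally show ?thesis .
  qed
  \<comment> \<open>Each factor \<open>1 - q^(-a)\<close> is rewritten as
    \<open>-q^(-a) (1 - q^a)\<close>; the monomials are collected in front and later moved to the
    other side.\<close>
  also have "\<dots> = (\<Prod>j<N. (- 1) * q powi (int c - 2 * int r * (int j + 1)) * (1 - q ^ (2*r*(j+1) -
      c)))"
  proof (intro prod.cong refl)
    fix j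
    have "c \<le> 2*r*(j+1)" using assms by simp
    then have "int (2*r*(j+1) - c) = 2 * int r * (int j + 1) - int c"
      by (simp add: of_nat_diff algebra_simps)
    then have "q powi (int c - 2 * int r * (int j + 1)) * q ^ (2*r*(j+1) - c) = 1"
      unfolding NP P by simp
    then show "1 - q powi (int c - 2 * int r * (int j + 1)) =
       (- 1) * q powi (int c - 2 * int r * (int j + 1)) * (1 - q ^ (2*r*(j+1) - c))"
      by (simp add: right_diff_distrib)
  qed
  also have "\<dots> = (-1) ^ N * q powi (int c * int N - int r * int N * (int N + 1)) * (\<Prod>j<N. 1 - q
      ^ (2*r*(j+1) - c))"
  proof -
    have "(\<Prod>j<N. q powi (int c - 2 * int r * (int j + 1))) = q powi (int c * int N - int r * int
        N * (int N + 1))"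
    proof (induction N)
      case (Suc N)
      then show ?case by (simp add: P) (simp add: algebra_simps)
    qed simp
    then show ?thesis by (simp only: prod.distrib prod_constant card_lessThan)
  qed
  finally have "(-1) ^ N * q powi (int c * int N - int r * int N * (int N + 1)) * (\<Prod>j<N. 1 - q ^
      (2*r*(j+1) - c))
       * (\<Prod>j<N. 1 - q ^ (c + 2*r*j)) =
     (\<Sum>s\<le>2*N. (q ^ r) ^ (s * (s - 1)) * qbinom (q ^ r) (2*N) s * (- (q powi e)) ^ s)" .
  then have "((-1) ^ N * q powi - (int c * int N - int r * int N * (int N + 1))) *
    ((-1) ^ N * q powi (int c * int N - int r * int N * (int N + 1)) * (\<Prod>j<N. 1 - q ^ (2*r*(j+1)
        - c))
       * (\<Prod>j<N. 1 - q ^ (c + 2*r*j))) =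
     ((-1) ^ N * q powi - (int c * int N - int r * int N * (int N + 1))) *
     (\<Sum>s\<le>2*N. (q ^ r) ^ (s * (s - 1)) * qbinom (q ^ r) (2*N) s * (- (q powi e)) ^ s)"
    by simp
  also have "((-1) ^ N * q powi - (int c * int N - int r * int N * (int N + 1))) *
    ((-1) ^ N * q powi (int c * int N - int r * int N * (int N + 1)) * (\<Prod>j<N. 1 - q ^ (2*r*(j+1)
        - c))
       * (\<Prod>j<N. 1 - q ^ (c + 2*r*j))) = (\<Prod>j<N. (1 - q ^ (c + 2*r*j)) * (1 - q ^ (2*r*(j+1) - c)))"
  proof -
    have "a * b * (a * d * x * y) = y * x" if "a * a = 1" "b * d = 1" for a b d x y :: "rat fls"
    proof -
      have "a * b * (a * d * x * y) = (a * a) * (b * d) * (y * x)"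
        by (simp only: mult_ac)
      then show ?thesis by (simp add: that)
    qed
    moreover have "(-1) ^ N * (-1) ^ N = (1 :: rat fls)"
      by (simp flip: power_add)
    moreover have "q powi - z * q powi z = 1" for z
      unfolding P by simp
    ultimately show ?thesis
      unfolding prod.distrib by blast
  qed
  also have "((-1) ^ N * q powi - (int c * int N - int r * int N * (int N + 1))) *
     (\<Sum>s\<le>2*N. (q ^ r) ^ (s * (s - 1)) * qbinom (q ^ r) (2*N) s * (- (q powi e)) ^ s) =
    (\<Sum>s\<le>2*N. (-1) ^ (N + s) * qbinom (q ^ r) (2*N) s *
       q powi (int r * (int s - int N) * (int s - int N - 1) + int c * (int s - int N)))"
    unfolding sum_distrib_left
  proof (intro sum.cong refl)
    fix s
    have s: "int (s * (s - 1)) = int s * (int s - 1)"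
      by (cases s) (auto simp: algebra_simps)
    have 1: "q powi - (int c * int N - int r * int N * (int N + 1)) * ((q ^ r) ^ (s * (s - 1)) *
        (q powi e) ^ s)
      = q powi (int r * (int s - int N) * (int s - int N - 1) + int c * (int s - int N))"
      unfolding power_mult [symmetric] pp NP P unfolding of_nat_mult[of r] s
      by (simp add: e_def algebra_simps)
    have 2: "(- (q powi e)) ^ s = (-1) ^ s * (q powi e) ^ s"
      by (rule power_minus)
    show "(-1) ^ N * q powi - (int c * int N - int r * int N * (int N + 1)) *
      ((q ^ r) ^ (s * (s - 1)) * qbinom (q ^ r) (2*N) s * (- (q powi e)) ^ s) =
      (-1) ^ (N + s) * qbinom (q ^ r) (2*N) s *
       q powi (int r * (int s - int N) * (int s - int N - 1) + int c * (int s - int N))"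
      unfolding 1 [symmetric] 2 by (simp only: power_add mult_ac)
  qed
  finally show ?thesis .
qed

lemma qfact_q: "qfact (q ^ r) n = (\<Prod>j<n. 1 - q ^ (2*r*(j+1)))"
  unfolding qfact_def by (simp only: power_mult [symmetric] mult_ac Suc_eq_plus1)

text \<open>The two products share their first \<open>a\<close> factors; every other factor is
  \<open>1 - q^(2r(j+1))\<close> with \<open>j \<ge> a\<close>.\<close>

lemma near1_qfact_quot:
  assumes r: "r \<ge> 1" and "a \<le> x" "a \<le> y"
  shows "near1 (2 * int r * (int a + 1)) (qfact (q ^ r) x / qfact (q ^ r) y)"
proof -
  have "(q ^ r) ^ (2 * j) \<noteq> 1" if "j > 0" for j
    using one_minus_q_nonzero[of "r * (2 * j)"] that r by (simp add: power_mult)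
  then have nz: "qfact (q ^ r) n \<noteq> 0" for n
    by (rule qfact_nonzero)
  have pos: "2 * int r * (int a + 1) \<ge> 1"
  proof -
    have "1 * 1 \<le> int r * (int a + 1)" using r by (intro mult_mono) auto
    then show ?thesis by simp
  qed
  have *: "near1 (2 * int r * (int a + 1)) (qfact (q ^ r) x / qfact (q ^ r) a)" if "a \<le> x" for x
  proof -
    have "{..<x} = {..<a} \<union> {a..<x}" using that by auto
    then have "qfact (q ^ r) x = qfact (q ^ r) a * (\<Prod>j=a..<x. 1 - q ^ (2*r*(j+1)))"
      unfolding qfact_q by (simp add: prod.union_disjoint ivl_disj_int)
    then have "qfact (q ^ r) x / qfact (q ^ r) a = (\<Prod>j=a..<x. 1 - q ^ (2*r*(j+1)))"
      using nz by simp
    also have "near1 (2 * int r * (int a + 1)) \<dots>"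
    proof (intro near1_prod pos near1_1_minus)
      fix j assume "j \<in> {a..<x}"
      then have "2*r*(a+1) \<le> 2*r*(j+1)" by simp
      then have "int (2*r*(a+1)) \<le> int (2*r*(j+1))" by (simp only: of_nat_le_iff)
      then show "2 * int r * (int a + 1) \<le> int (2*r*(j+1))" by (simp add: algebra_simps)
    qed
    finally show ?thesis .
  qed
  have e: "qfact (q ^ r) x / qfact (q ^ r) y = (qfact (q ^ r) x / qfact (q ^ r) a) / (qfact (q ^
      r) y / qfact (q ^ r) a)"
    using nz by simp
  show ?thesis
    unfolding e by (rule near1_divide[OF *[OF assms(2)] *[OF assms(3)] pos])
qed

text \<open>The finite identity is multiplied by \<open>qfact (q^r) N\<close>, which brings each
  Gaussian binomial close to 1. The approximation is poor near the ends of the range of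
  \<open>s\<close>, but there the monomial \<open>q^(e s)\<close> has high order.\<close>

lemma Jacobi_triple_approx:
  fixes r c N :: nat
  assumes r: "r \<ge> 1" and c: "c \<le> r"
  shows "ord_ge (2 * int N) ((\<Sum>s\<le>2*N. (-1) ^ (N + s) *
        q powi (int r * (int s - int N) * (int s - int N - 1) + int c * (int s - int N)))
     - (\<Prod>j<N. (1 - q ^ (c + 2*r*j)) * (1 - q ^ (2*r*(j+1) - c)) * (1 - q ^ (2*r*(j+1)))))"
proof -
  define e where "e s = int r * (int s - int N) * (int s - int N - 1) + int c * (int s - int N)"
      for s
  have "(\<Prod>j<N. (1 - q ^ (c + 2*r*j)) * (1 - q ^ (2*r*(j+1) - c)) * (1 - q ^ (2*r*(j+1))))
    = qfact (q ^ r) N * (\<Prod>j<N. (1 - q ^ (c + 2*r*j)) * (1 - q ^ (2*r*(j+1) - c)))"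
    unfolding qfact_q prod.distrib by (simp only: mult_ac)
  also have "\<dots> = (\<Sum>s\<le>2*N. (-1) ^ (N + s) * q powi e s * (qfact (q ^ r) N * qbinom (q ^ r) (2*N) s))"
    unfolding finite_Jacobi_triple[OF assms] e_def sum_distrib_left by (simp only: mult_ac)
  finally have p: "(\<Prod>j<N. (1 - q ^ (c + 2*r*j)) * (1 - q ^ (2*r*(j+1) - c)) * (1 - q ^
      (2*r*(j+1)))) = \<dots>" .
  have "ord_ge (2 * int N) ((-1) ^ (N + s) * q powi e s - (-1) ^ (N + s) * q powi e s * (qfact
      (q ^ r) N * qbinom (q ^ r) (2*N) s))"
    if s: "s \<le> 2*N" for s
  proof -
    define a where "a = min s (2*N - s)"
    have pos: "2 * int r * (int a + 1) \<ge> 1"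
    proof -
      have "1 * 1 \<le> int r * (int a + 1)" using r by (intro mult_mono) auto
      then show ?thesis by simp
    qed
    have "qfact (q ^ r) N * qbinom (q ^ r) (2*N) s = (qfact (q ^ r) N / qfact (q ^ r) s) *
        (qfact (q ^ r) (2*N) / qfact (q ^ r) (2*N - s))"
      by (simp add: qbinom_def)
    also have "near1 (2 * int r * (int a + 1)) \<dots>"
      using s by (intro near1_mult near1_qfact_quot r pos) (auto simp: a_def min_def)
    finally have "ord_ge (0 + e s + 2 * int r * (int a + 1)) ((-1) ^ (N + s) * q powi e s *
        (qfact (q ^ r) N * qbinom (q ^ r) (2*N) s - 1))"
      by (intro ord_ge_mult ord_ge_neg_one_power ord_ge_q_powi) auto
    moreover have "2 * int N \<le> e s + 2 * int r * (int a + 1)"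
    proof -
      \<comment> \<open>In terms of \<open>t\<close> the claim is
        \<open>r(t-1)(t-2) + ct \<ge> 0\<close> for \<open>t \<ge> 0\<close>, and
        \<open>r((t+1)^2 + 1) + (r-c)(-t) \<ge> 0\<close> for \<open>t < 0\<close>.\<close>
      define t where "t = int s - int N"
      have a: "int a = int N - \<bar>t\<bar>"
        using s by (auto simp: a_def t_def min_def)
      have "int r * (2 * int N) \<le> e s + 2 * int r * (int a + 1)"
      proof (cases "t \<ge> 0")
        case True
        have "0 \<le> int r * ((t - 1) * (t - 2)) + int c * t"
          using True by (cases "t = 1"; cases "t = 0") (auto intro!: add_nonneg_nonneg
              mult_nonneg_nonneg)
        then show ?thesis
          unfolding a e_def t_def [symmetric] using True by (simp add: algebra_simps)
      next
        case False
        have "0 \<le> int r * ((t + 1) * (t + 1) + 1) + (int r - int c) * (- t)"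
          using False c
          by (intro add_nonneg_nonneg mult_nonneg_nonneg[of "int r"] mult_nonneg_nonneg[of "int
              r - int c"]) auto
        then show ?thesis
          unfolding a e_def t_def [symmetric] using False by (simp add: algebra_simps)
      qed
      moreover have "1 * (2 * int N) \<le> int r * (2 * int N)"
        using r by (intro mult_right_mono) auto
      ultimately show ?thesis by linarith
    qed
    ultimately have "ord_ge (2 * int N) (- ((-1) ^ (N + s) * q powi e s * (qfact (q ^ r) N *
        qbinom (q ^ r) (2*N) s - 1)))"
      by (auto elim: ord_ge_mono)
    then show ?thesis
      by (simp add: right_diff_distrib)
  qed
  then show ?thesis
    unfolding p e_def [symmetric] sum_subtractf [symmetric] by (intro ord_ge_sum) auto
qed

subsection \<open>Generating functions of overpartitions\<close>

text \<open>An infinite fibre would be counted as 0 by \<open>card\<close>; hence the finiteness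
  assumptions in the sum and product rules.\<close>

definition gf :: "('a \<Rightarrow> nat) \<Rightarrow> 'a set \<Rightarrow> rat fps" where
  "gf w A = Abs_fps (\<lambda>n. of_nat (card {x \<in> A. w x = n}))"

lemma gf_nth [simp]: "fps_nth (gf w A) n = of_nat (card {x \<in> A. w x = n})"
  by (simp add: gf_def)

lemma gf_bij:
  assumes "bij_betw f A B" "\<And>x. x \<in> A \<Longrightarrow> w' (f x) = w x"
  shows "gf w A = gf w' B"
proof (rule fps_ext)
  fix n
  have "bij_betw f {x \<in> A. w x = n} {y \<in> B. w' y = n}"
    using assms by (auto simp: bij_betw_def inj_on_def)
  then show "fps_nth (gf w A) n = fps_nth (gf w' B) n"
    by (simp add: bij_betw_same_card)
qed

lemma gf_Sigma:
  assumes "finite I" "\<And>i n. i \<in> I \<Longrightarrow> finite {y \<in> A i. w (i, y) = n}"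
  shows "gf w (Sigma I A) = (\<Sum>i\<in>I. gf (\<lambda>y. w (i, y)) (A i))"
proof (rule fps_ext)
  fix n
  have "{x \<in> Sigma I A. w x = n} = (SIGMA i:I. {y \<in> A i. w (i, y) = n})"
    by auto
  then show "fps_nth (gf w (Sigma I A)) n = fps_nth (\<Sum>i\<in>I. gf (\<lambda>y. w (i, y)) (A i)) n"
    using assms by (simp add: fps_sum_nth card_SigmaI)
qed

lemma gf_times:
  assumes "\<And>n. finite {x \<in> A. w x = n}" "\<And>n. finite {y \<in> B. v y = n}"
  shows "gf (\<lambda>(x, y). w x + v y) (A \<times> B) = gf w A * gf v B"
proof (rule fps_ext)
  fix n
  have "{p \<in> A \<times> B. (case p of (x, y) \<Rightarrow> w x + v y) = n} =
      (\<Union>j\<in>{0..n}. {x \<in> A. w x = j} \<times> {y \<in> B. v y = n - j})"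
    by auto
  then have "card {p \<in> A \<times> B. (case p of (x, y) \<Rightarrow> w x + v y) = n} =
      (\<Sum>j\<in>{0..n}. card ({x \<in> A. w x = j} \<times> {y \<in> B. v y = n - j}))"
    by (simp only:) (intro card_UN_disjoint, use assms in auto)
  then show "fps_nth (gf (\<lambda>(x, y). w x + v y) (A \<times> B)) n = fps_nth (gf w A * gf v B) n"
    by (simp add: fps_mult_nth card_cartesian_product)
qed

lemma gf_shift: "gf (\<lambda>x. j + w x) A = fps_X ^ j * gf w A"
proof (rule fps_ext)
  fix n
  have "{x \<in> A. j + w x = n} = (if n < j then {} else {x \<in> A. w x = n - j})"
    by auto
  then show "fps_nth (gf (\<lambda>x. j + w x) A) n = fps_nth (fps_X ^ j * gf w A) n"
    by (simp add: fps_X_power_mult_nth)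
qed

lemma gf_multiples:
  assumes "0 < j"
  shows "(1 - fps_X ^ j) * gf (\<lambda>s. s * j) UNIV = 1"
proof (rule fps_ext)
  fix n
  have *: "card {s. s * j = m} = (if j dvd m then 1 else 0)" for m
  proof (cases "j dvd m")
    case True
    then have "{s. s * j = m} = {m div j}" using assms by auto
    then show ?thesis using True by simp
  next
    case False
    then have "{s. s * j = m} = {}" by auto
    then show ?thesis using False by simp
  qed
  have "j dvd n \<and> n < j \<longleftrightarrow> n = 0"
    using assms by (auto dest: nat_dvd_not_less)
  moreover have "j dvd n - j \<longleftrightarrow> j dvd n" if "\<not> n < j"
    using that by (simp add: dvd_minus_self)
  ultimately show "fps_nth ((1 - fps_X ^ j) * gf (\<lambda>s. s * j) UNIV) n = fps_nth 1 n"
    using assms by (auto simp: left_diff_distrib fps_X_power_mult_nth *)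
qed

section \<open>Generating functions as Laurent series, where they meet the explicit solution\<close>

definition GF :: "('a \<Rightarrow> nat) \<Rightarrow> 'a set \<Rightarrow> rat fls" where
  "GF w A = fps_to_fls (gf w A)"

lemma GF_nth: "fls_nth (GF w A) (int n) = of_nat (card {x \<in> A. w x = n})"
  by (simp add: GF_def)

lemma ord_ge_GF [simp]: "ord_ge 0 (GF w A)"
  by (simp add: GF_def)

lemma GF_bij:
  "bij_betw f A B \<Longrightarrow> (\<And>x. x \<in> A \<Longrightarrow> w' (f x) = w x) \<Longrightarrow> GF w A = GF w' B"
  unfolding GF_def using gf_bij[of f A B w' w] by simp

lemma fps_to_fls_sum: "fps_to_fls (sum f I) = (\<Sum>i\<in>I. fps_to_fls (f i))"
  by (induction I rule: infinite_finite_induct) auto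

lemma GF_Sigma:
  "finite I \<Longrightarrow> (\<And>i n. i \<in> I \<Longrightarrow> finite {y \<in> A i. w (i, y) = n}) \<Longrightarrow>
   GF w (Sigma I A) = (\<Sum>i\<in>I. GF (\<lambda>y. w (i, y)) (A i))"
  unfolding GF_def by (simp add: gf_Sigma fps_to_fls_sum)

lemma GF_times:
  "(\<And>n. finite {x \<in> A. w x = n}) \<Longrightarrow> (\<And>n. finite {y \<in> B. v y = n}) \<Longrightarrow>
   GF (\<lambda>(x, y). w x + v y) (A \<times> B) = GF w A * GF v B"
  unfolding GF_def by (simp add: gf_times fls_times_fps_to_fls)

lemma GF_shift: "GF (\<lambda>x. j + w x) A = q ^ j * GF w A"
  unfolding GF_def q_def by (simp add: gf_shift fls_times_fps_to_fls fps_to_fls_power)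

lemma GF_multiples:
  assumes "0 < j"
  shows "GF (\<lambda>s. s * j) UNIV = 1 / (1 - q ^ j)"
proof -
  have "(1 - q ^ j) * GF (\<lambda>s. s * j) UNIV = fps_to_fls ((1 - fps_X ^ j) * gf (\<lambda>s. s * j) UNIV)"
    unfolding GF_def q_def by (simp add: fls_times_fps_to_fls fps_to_fls_power)
  then have "(1 - q ^ j) * GF (\<lambda>s. s * j) UNIV = 1"
    unfolding gf_multiples[OF assms] by simp
  then show ?thesis
    using nonzero_mult_div_cancel_left[OF one_minus_q_nonzero[OF assms], of "GF (\<lambda>s. s * j)
        UNIV"] by simp
qed

lemma GF_singleton: "w x = 0 \<Longrightarrow> GF w {x} = 1"
proof -
  assume "w x = 0"
  then have "{y \<in> {x}. w y = n} = (if n = 0 then {x} else {})" for n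
    by auto
  then show ?thesis
    by (auto simp: GF_def fps_eq_iff)
qed

section \<open>Overpartitions as pairs of non-overlined and overlined parts\<close>

definition wt :: "nat multiset \<times> nat set \<Rightarrow> nat" where
  "wt = (\<lambda>(U, V). sum_mset U + \<Sum>V)"

text \<open>Unlike in \<open>overpartition\<close>, the multiset holds the non-overlined parts only.
  The components are then independent and the weight is additive.\<close>

definition opairs :: "(nat multiset \<times> nat set) set" where
  "opairs = {(U, V). 0 \<notin># U \<and> finite V \<and> 0 \<notin> V}"

lemma member_le_sum_mset: "t \<in># U \<Longrightarrow> t \<le> sum_mset (U :: nat multiset)"
  by (auto dest!: multi_member_split)

lemma member_le_Sum: "finite V \<Longrightarrow> t \<in> V \<Longrightarrow> t \<le> \<Sum>(V :: nat set)"
  using member_le_sum[of t V "\<lambda>x. x"] by simp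

lemma finite_opairs: "finite {x \<in> opairs. wt x = n}"
proof (rule finite_subset)
  show "{x \<in> opairs. wt x = n} \<subseteq> (\<Union>j\<le>n. partitions j) \<times> Pow {..n}"
  proof safe
    fix U V assume "(U, V) \<in> opairs" "n = wt (U, V)"
    then have "U \<in> partitions (sum_mset U)" "sum_mset U \<le> wt (U, V)"
      by (auto simp: opairs_def wt_def partitions_def)
    then show "U \<in> (\<Union>j\<le>wt (U, V). partitions j)"
      by blast
  next
    fix U V t assume "(U, V) \<in> opairs" "n = wt (U, V)" "t \<in> V"
    then have "t \<le> \<Sum>V" by (auto simp: opairs_def intro: member_le_Sum)
    then show "t \<le> wt (U, V)" by (simp add: wt_def)
  qed
qed (simp add: finite_partitions)

lemma finite_wt: "A \<subseteq> opairs \<Longrightarrow> finite {x \<in> A. wt x = n}"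
  by (rule finite_subset[OF _ finite_opairs[of n]]) auto

text \<open>One copy of each overlined size is removed from, or returned to, the multiset. The
  predicate \<open>Q\<close> is kept general so that both sides of the theorem can be
  translated.\<close>

lemma card_overpartitions:
  "card {l \<in> overpartitions n. Q (f_non l) (snd l)} =
   card {x \<in> opairs. Q (count (fst x)) (snd x) \<and> wt x = n}"
proof -
  define f where "f = (\<lambda>(M, S). (M - mset_set S, S :: nat set))"
  define g where "g = (\<lambda>(U, V). (U + mset_set V, V :: nat set))"
  have sub: "mset_set S \<subseteq># M" if "S \<subseteq> set_mset M" for S and M :: "nat multiset"
    using that finite_subset[OF that] by (auto intro!: mset_subset_eqI simp: count_mset_set')
  have fn: "f_non l = count (fst (f l))" if "l \<in> overpartitions n" for l
  proof -
    obtain M S where l: "l = (M, S)" by (cases l)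
    have "finite S"
      using that finite_subset[of S "set_mset M"] by (simp add: l overpartitions_def)
    then show ?thesis
      by (intro ext) (simp add: l f_non_def f_over_def f_def count_mset_set')
  qed
  have "bij_betw f {l \<in> overpartitions n. Q (f_non l) (snd l)} {x \<in> opairs. Q (count (fst x))
      (snd x) \<and> wt x = n}"
  proof (rule bij_betw_byWitness[where f' = g])
    show "\<forall>l\<in>{l \<in> overpartitions n. Q (f_non l) (snd l)}. g (f l) = l"
      by (auto simp: overpartitions_def f_def g_def sub)
    show "\<forall>x\<in>{x \<in> opairs. Q (count (fst x)) (snd x) \<and> wt x = n}. f (g x) = x"
      by (auto simp: f_def g_def)
    show "f ` {l \<in> overpartitions n. Q (f_non l) (snd l)} \<subseteq> {x \<in> opairs. Q (count (fst x)) (snd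
        x) \<and> wt x = n}"
    proof (rule image_subsetI)
      fix l assume "l \<in> {l \<in> overpartitions n. Q (f_non l) (snd l)}"
      then have l: "l \<in> overpartitions n" and Q: "Q (f_non l) (snd l)"
        by auto
      obtain M S where MS: "l = (M, S)" by (cases l)
      have S: "S \<subseteq> set_mset M" "0 \<notin># M" "sum_mset M = n" "finite S"
        using l MS finite_subset[of S "set_mset M"] by (auto simp: overpartitions_def
            partitions_def)
      have "sum_mset (M - mset_set S + mset_set S) = n"
        unfolding subset_mset.diff_add[OF sub[OF S(1)]] by (rule S(3))
      then have "wt (f l) = n"
        using S by (simp add: MS f_def wt_def sum_unfold_sum_mset)
      moreover have "f l \<in> opairs"
        using S by (auto simp: MS f_def opairs_def dest: in_diffD)
      moreover have "Q (count (fst (f l))) (snd (f l))"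
        using Q unfolding fn[OF l] by (simp add: MS f_def)
      ultimately show "f l \<in> {x \<in> opairs. Q (count (fst x)) (snd x) \<and> wt x = n}"
        by simp
    qed
    show "g ` {x \<in> opairs. Q (count (fst x)) (snd x) \<and> wt x = n} \<subseteq> {l \<in> overpartitions n. Q
        (f_non l) (snd l)}"
    proof (rule image_subsetI)
      fix x assume "x \<in> {x \<in> opairs. Q (count (fst x)) (snd x) \<and> wt x = n}"
      then have x: "x \<in> opairs" and Q: "Q (count (fst x)) (snd x)" and n: "wt x = n"
        by auto
      obtain U V where UV: "x = (U, V)" by (cases x)
      have l: "g x \<in> overpartitions n"
        unfolding n [symmetric] using x
        by (simp add: UV g_def wt_def opairs_def overpartitions_def partitions_def
            sum_unfold_sum_mset)
      have fx: "f (g x) = x" by (simp add: UV f_def g_def)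
      have "snd (g x) = snd x"
        by (simp add: UV g_def)
      then have "Q (f_non (g x)) (snd (g x))"
        unfolding fn[OF l] fx using Q by simp
      then show "g x \<in> {l \<in> overpartitions n. Q (f_non l) (snd l)}"
        using l by simp
    qed
  qed
  then show ?thesis by (rule bij_betw_same_card)
qed

subsection \<open>The recurrence for the restricted overpartitions\<close>

text \<open>Strict bounds and \<open>+ 2 \<le> k\<close> express the conditions over the naturals,
  and index 0 gives the empty set. The second condition starts at \<open>t = m + 1\<close>: for
  \<open>i \<le> k\<close> its instance at \<open>m\<close> follows from the first, there being no
  part \<open>2m\<close>.\<close>

definition restr :: "nat \<Rightarrow> nat \<Rightarrow> nat \<Rightarrow> (nat multiset \<times> nat set) set" where
  "restr k m i = {(U, V). finite V \<and> (\<forall>t\<in>#U. 2*m < t) \<and> (\<forall>t\<in>V. 2*m < t) \<and>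
     of_bool (2*m+1 \<in> V) + count U (2*m+2) < i \<and>
     (\<forall>t>m. of_bool (2*t \<in> V) + count U (2*t) + of_bool (2*t+1 \<in> V) + count U (2*t+2) < k) \<and>
     (\<forall>t\<ge>m. count U (2*t+1) \<ge> 1 \<longrightarrow> count U (2*t+2) + 2 \<le> k)}"

lemma restr_subset_opairs: "restr k m i \<subseteq> opairs"
  by (auto simp: restr_def opairs_def)

lemma restr_0 [simp]: "restr k m 0 = {}"
  by (auto simp: restr_def)

lemma GF_empty [simp]: "GF w {} = 0"
  by (simp add: GF_def fps_eq_iff)

text \<open>\<open>a\<close> and \<open>c\<close> record overlined parts \<open>2m+1\<close> and
  \<open>2m+2\<close>; \<open>s\<close> and \<open>b\<close> are the numbers of non-overlined
  ones.\<close>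

definition glue :: "nat \<Rightarrow> (bool \<times> nat \<times> bool) \<times> nat \<times> nat multiset \<times> nat set \<Rightarrow> nat multiset \<times>
    nat set" where
  "glue m = (\<lambda>((a, b, c), s, U, V). (U + replicate_mset s (2*m+1) + replicate_mset b (2*m+2),
     V \<union> (if a then {2*m+1} else {}) \<union> (if c then {2*m+2} else {})))"

text \<open>The part \<open>2m+1\<close> may be repeated freely or not at all, according to the
  third condition at \<open>t = m\<close>. The second condition at \<open>t = m + 1\<close> becomes
  the first condition on the remaining parts, with index \<open>k - b - c\<close>.\<close>

definition restr_dom :: "nat \<Rightarrow> nat \<Rightarrow> nat \<Rightarrow> ((bool \<times> nat \<times> bool) \<times> nat \<times> nat multiset \<times> nat set)
    set" where
  "restr_dom k m i = (SIGMA (a, b, c) : (SIGMA a:UNIV. {..<i - of_bool a} \<times> UNIV).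
     (if b + 2 \<le> k then UNIV else {0}) \<times> restr k (Suc m) (k - b - of_bool c))"

lemma glue_arg_cases:
  obtains a b c s U V where "x = ((a, b, c), s, U, V)"
proof -
  obtain abc y where "x = (abc, y)" by (cases x)
  moreover obtain a b c where "abc = (a, b, c)" by (cases abc)
  moreover obtain s U V where "y = (s, U, V)" by (cases y)
  ultimately show thesis using that by blast
qed

lemma glue_in_restr:
  assumes "x \<in> restr_dom k m i"
  shows "glue m x \<in> restr k m i"
proof -
  obtain a b c s U V where x: "x = ((a, b, c), s, U, V)"
    by (rule glue_arg_cases)
  have b: "of_bool a + b < i" and s: "s > 0 \<Longrightarrow> b + 2 \<le> k" and
    UV: "(U, V) \<in> restr k (Suc m) (k - b - of_bool c)"
    using assms by (auto simp: restr_dom_def x split: if_splits)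
  define U' where "U' = U + replicate_mset s (2*m+1) + replicate_mset b (2*m+2)"
  define V' where "V' = V \<union> (if a then {2*m+1} else {}) \<union> (if c then {2*m+2} else {})"
  have fin: "finite V" and U: "\<And>t. t \<in># U \<Longrightarrow> 2*m+2 < t" and V: "\<And>t. t \<in> V \<Longrightarrow> 2*m+2 < t"
    and c1: "of_bool (2*m+3 \<in> V) + count U (2*m+4) < k - b - of_bool c"
    and c2: "\<And>t. t > Suc m \<Longrightarrow> of_bool (2*t \<in> V) + count U (2*t) + of_bool (2*t+1 \<in> V) + count U
        (2*t+2) < k"
    and c3: "\<And>t. t \<ge> Suc m \<Longrightarrow> count U (2*t+1) \<ge> 1 \<Longrightarrow> count U (2*t+2) + 2 \<le> k"
    using UV by (auto simp: restr_def eval_nat_numeral)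
  have U0: "count U (2*m+1) = 0" "count U (2*m+2) = 0"
    using U by (force simp: count_eq_zero_iff)+
  have V0: "2*m+1 \<notin> V" "2*m+2 \<notin> V"
    using V by force+
  have Uc: "count U' (2*m+1) = s" "count U' (2*m+2) = b" "\<And>t. 2*m+2 < t \<Longrightarrow> count U' t = count U t"
    using U0 by (auto simp: U'_def)
  have Vc: "2*m+1 \<in> V' \<longleftrightarrow> a" "2*m+2 \<in> V' \<longleftrightarrow> c" "\<And>t. 2*m+2 < t \<Longrightarrow> t \<in> V' \<longleftrightarrow> t \<in> V"
    using V0 by (auto simp: V'_def)
  have "\<forall>t>m. of_bool (2*t \<in> V') + count U' (2*t) + of_bool (2*t+1 \<in> V') + count U' (2*t+2) < k"
  proof (intro allI impI)
    fix t assume "m < t"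
    show "of_bool (2*t \<in> V') + count U' (2*t) + of_bool (2*t+1 \<in> V') + count U' (2*t+2) < k"
    \<comment> \<open>Only this instance involves both the small parts and the remaining
      ones.\<close>
    proof (cases "t = Suc m")
      case True
      have e: "2 * Suc m = 2*m+2" "2*m+2+1 = 2*m+3" "2*m+2+2 = 2*m+4" by auto
      have e': "count U' (2*m+4) = count U (2*m+4)" "2*m+3 \<in> V' \<longleftrightarrow> 2*m+3 \<in> V"
        by (auto intro!: Uc(3) Vc(3))
      show ?thesis
        unfolding True e(1) unfolding e(2,3) e' Uc(2) Vc(2) using c1 by linarith
    next
      case False
      then show ?thesis
        using c2[of t] \<open>m < t\<close> by (simp add: Uc(3) Vc(3))
    qed
  qed
  moreover have "\<forall>t\<ge>m. count U' (2*t+1) \<ge> 1 \<longrightarrow> count U' (2*t+2) + 2 \<le> k"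
  proof (intro allI impI)
    fix t assume "m \<le> t" and *: "count U' (2*t+1) \<ge> 1"
    show "count U' (2*t+2) + 2 \<le> k"
    proof (cases "t = m")
      case True
      then show ?thesis
        using * s unfolding True Uc(1,2) by simp
    next
      case False
      then show ?thesis
        using c3[of t] \<open>m \<le> t\<close> * by (simp add: Uc(3))
    qed
  qed
  moreover have "finite V'"
    using fin by (simp add: V'_def)
  moreover have "\<forall>t\<in>V'. 2*m < t"
  proof
    fix t assume "t \<in> V'"
    then have "t \<in> V \<or> t = 2*m+1 \<or> t = 2*m+2"
      by (auto simp: V'_def split: if_splits)
    then show "2*m < t" using V[of t] by linarith
  qed
  moreover have "\<forall>t\<in>#U'. 2*m < t"
  proof
    fix t assume "t \<in># U'"
    then have "t \<in># U \<or> t = 2*m+1 \<or> t = 2*m+2"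
      by (auto simp: U'_def split: if_splits)
    then show "2*m < t" using U[of t] by linarith
  qed
  moreover have "of_bool (2*m+1 \<in> V') + count U' (2*m+2) < i"
    unfolding Uc(2) Vc(1) by (rule b)
  ultimately have "(U', V') \<in> restr k m i"
    unfolding restr_def by blast
  then show ?thesis
    by (simp add: glue_def x U'_def V'_def)
qed

text \<open>The inverse \<open>h\<close> reads off the multiplicities of \<open>2m+1\<close> and
  \<open>2m+2\<close> and keeps the larger parts.\<close>

lemma bij_glue: "bij_betw (glue m) (restr_dom k m i) (restr k m i)"
proof (rule bij_betw_byWitness)
  define h where "h = (\<lambda>(U, V). ((2*m+1 \<in> V, count U (2*m+2), 2*m+2 \<in> V), count U (2*m+1),
     filter_mset (\<lambda>t. 2*m+2 < t) U, V \<inter> {2*m+2<..}))"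
  show "\<forall>x\<in>restr_dom k m i. h (glue m x) = x"
  proof
    fix x assume "x \<in> restr_dom k m i"
    obtain a b c s U V where x: "x = ((a, b, c), s, U, V)"
      by (rule glue_arg_cases)
    have UV: "(U, V) \<in> restr k (Suc m) (k - b - of_bool c)"
      using \<open>x \<in> restr_dom k m i\<close> by (auto simp: restr_dom_def x)
    then have U: "\<And>t. t \<in># U \<Longrightarrow> 2*m+2 < t" and V: "\<And>t. t \<in> V \<Longrightarrow> 2*m+2 < t"
      by (auto simp: restr_def)
    have U0: "count U (2*m+1) = 0" "count U (2*m+2) = 0"
      using U by (force simp: count_eq_zero_iff)+
    have V0: "2*m+1 \<notin> V" "2*m+2 \<notin> V"
      using V by force+
    have "filter_mset (\<lambda>t. 2*m+2 < t) U = U"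
      using U by (simp add: filter_mset_eq_conv)
    moreover have "V \<inter> {2*m+2<..} = V"
      using V by auto
    ultimately show "h (glue m x) = x"
      using U0 V0 by (auto simp: x glue_def h_def Int_Un_distrib2)
  qed
  show "\<forall>y\<in>restr k m i. glue m (h y) = y"
  proof
    fix y assume "y \<in> restr k m i"
    obtain U V where y: "y = (U, V)" by (cases y)
    have U: "\<And>t. t \<in># U \<Longrightarrow> 2*m < t" and V: "\<And>t. t \<in> V \<Longrightarrow> 2*m < t"
      using \<open>y \<in> restr k m i\<close> by (auto simp: restr_def y)
    have "filter_mset (\<lambda>t. 2*m+2 < t) U + replicate_mset (count U (2*m+1)) (2*m+1)
        + replicate_mset (count U (2*m+2)) (2*m+2) = U"
    proof (rule multiset_eqI)
      fix t
      have zero: "count U t = 0" if "t \<le> 2*m"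
        using U[of t] that by (auto simp: count_eq_zero_iff)
      consider "t = 2*m+1" | "t = 2*m+2" | "2*m+2 < t" | "t \<le> 2*m" by linarith
      then show "count (filter_mset (\<lambda>t. 2*m+2 < t) U + replicate_mset (count U (2*m+1)) (2*m+1)
        + replicate_mset (count U (2*m+2)) (2*m+2)) t = count U t"
        using zero by cases auto
    qed
    moreover have "V \<inter> {2*m+2<..} \<union> (if 2*m+1 \<in> V then {2*m+1} else {}) \<union> (if 2*m+2 \<in> V then
        {2*m+2} else {}) = V"
    proof -
      have "t \<in> V \<Longrightarrow> t = 2*m+1 \<or> t = 2*m+2 \<or> 2*m+2 < t" for t
        using V[of t] by linarith
      then show ?thesis by (auto split: if_splits)
    qed
    ultimately show "glue m (h y) = y"
      by (simp add: y glue_def h_def)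
  qed
  show "glue m ` restr_dom k m i \<subseteq> restr k m i"
    using glue_in_restr by blast
  show "h ` restr k m i \<subseteq> restr_dom k m i"
  proof (rule image_subsetI)
    fix y assume "y \<in> restr k m i"
    obtain U V where y: "y = (U, V)" by (cases y)
    have fin: "finite V" and U: "\<And>t. t \<in># U \<Longrightarrow> 2*m < t" and V: "\<And>t. t \<in> V \<Longrightarrow> 2*m < t"
      and c1: "of_bool (2*m+1 \<in> V) + count U (2*m+2) < i"
      and c2: "\<And>t. t > m \<Longrightarrow> of_bool (2*t \<in> V) + count U (2*t) + of_bool (2*t+1 \<in> V) + count U
          (2*t+2) < k"
      and c3: "\<And>t. t \<ge> m \<Longrightarrow> count U (2*t+1) \<ge> 1 \<Longrightarrow> count U (2*t+2) + 2 \<le> k"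
      using \<open>y \<in> restr k m i\<close> unfolding restr_def y by blast+
    define U' where "U' = filter_mset (\<lambda>t. 2*m+2 < t) U"
    define V' where "V' = V \<inter> {2*m+2<..}"
    have Uc: "\<And>t. 2*m+2 < t \<Longrightarrow> count U' t = count U t"
      by (simp add: U'_def)
    have Vc: "\<And>t. 2*m+2 < t \<Longrightarrow> t \<in> V' \<longleftrightarrow> t \<in> V"
      by (simp add: V'_def)
    have "of_bool (2*m+2 \<in> V) + count U (2*m+2) + of_bool (2*m+3 \<in> V) + count U (2*m+4) < k"
    proof -
      have e: "2 * Suc m = 2*m+2" "2*m+2+1 = 2*m+3" "2*m+2+2 = 2*m+4" by auto
      show ?thesis using c2[of "Suc m"] unfolding e(1) unfolding e(2,3) by simp
    qed
    moreover have "2 * Suc m + 1 = 2*m+3" "2 * Suc m + 2 = 2*m+4" "2*m+3 \<in> V' \<longleftrightarrow> 2*m+3 \<in> V"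
      "count U' (2*m+4) = count U (2*m+4)"
      by (auto intro!: Uc Vc)
    ultimately have 1: "of_bool (2 * Suc m + 1 \<in> V') + count U' (2 * Suc m + 2) < k - count U
        (2*m+2) - of_bool (2*m+2 \<in> V)"
      by (simp only:)
    have 2: "\<forall>t>Suc m. of_bool (2*t \<in> V') + count U' (2*t) + of_bool (2*t+1 \<in> V') + count U'
        (2*t+2) < k"
      using c2 by (simp add: Uc Vc)
    have 3: "\<forall>t\<ge>Suc m. count U' (2*t+1) \<ge> 1 \<longrightarrow> count U' (2*t+2) + 2 \<le> k"
      using c3 by (simp add: Uc)
    have 4: "finite V' \<and> (\<forall>t\<in>#U'. 2 * Suc m < t) \<and> (\<forall>t\<in>V'. 2 * Suc m < t)"
      using fin by (simp add: U'_def V'_def)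
    have "(U', V') \<in> restr k (Suc m) (k - count U (2*m+2) - of_bool (2*m+2 \<in> V))"
      unfolding restr_def using 1 2 3 4 by blast
    moreover have "count U (2*m+1) = 0" if "\<not> count U (2*m+2) + 2 \<le> k"
    proof (rule ccontr)
      assume "count U (2*m+1) \<noteq> 0"
      then have "count U (2*m+1) \<ge> 1" by linarith
      then show False using c3[OF le_refl] that by blast
    qed
    moreover have "count U (2*m+2) < i - of_bool (2*m+1 \<in> V)"
      using c1 by linarith
    moreover have "h y = ((2*m+1 \<in> V, count U (2*m+2), 2*m+2 \<in> V), count U (2*m+1), U', V')"
      by (simp add: h_def y U'_def V'_def)
    ultimately show "h y \<in> restr_dom k m i"
      unfolding restr_dom_def by (cases "2*m+2 \<in> V") simp_all
  qed
qed

text \<open>Contribution of exactly \<open>b\<close> non-overlined parts \<open>2m+2\<close>,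
  without overlined \<open>2m+1\<close>: the geometric series counts non-overlined parts
  \<open>2m+1\<close>, the two summands distinguish whether \<open>2m+2\<close> is
  overlined.\<close>

definition restr_step :: "nat \<Rightarrow> nat \<Rightarrow> nat \<Rightarrow> rat fls" where
  "restr_step k m b = q ^ ((2*m+2)*b) * ((if b + 2 \<le> k then 1 / (1 - q ^ (2*m+1)) else 1) *
     (GF wt (restr k (Suc m) (k - b)) + q ^ (2*m+2) * GF wt (restr k (Suc m) (k - b - 1))))"

text \<open>The sum over \<open>restr_dom\<close> is split by \<open>a\<close>: an overlined part
  \<open>2m+1\<close> costs \<open>q^(2m+1)\<close> and lowers the bound on \<open>b\<close> by
  one.\<close>

lemma GF_restr_recurrence:
  "GF wt (restr k m i) = (\<Sum>b<i. restr_step k m b) + q ^ (2*m+1) * (\<Sum>b<i - 1. restr_step k m b)"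
proof -
  define D where "D b = (if b + 2 \<le> k then UNIV else {0::nat})" for b
  define sh where "sh = (\<lambda>(a, b, c). (2*m+1) * of_bool a + (2*m+2) * (b + of_bool c) :: nat)"
  define w' where "w' = (\<lambda>(abc, s, x). sh abc + (s * (2*m+1) + wt x))"
  define r where "r b = (if b + 2 \<le> k then 1 / (1 - q ^ (2*m+1)) else 1)" for b
  have GD: "GF (\<lambda>s. s * (2*m+1)) (D b) = r b" for b
    unfolding D_def r_def using GF_multiples[of "2*m+1"] GF_singleton[of "\<lambda>s. s * (2*m+1)" 0] by
        simp
  have finD: "finite {s \<in> D b. s * (2*m+1) = n}" for b n
    by (rule finite_subset[of _ "{..n}"]) auto
  have fin: "finite {y \<in> D b \<times> restr k (Suc m) j. w' (abc, y) = n}" for b j abc n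
  proof (rule finite_subset)
    show "{y \<in> D b \<times> restr k (Suc m) j. w' (abc, y) = n} \<subseteq> {..n} \<times> (\<Union>l\<le>n. {x \<in> opairs. wt x = l})"
      using restr_subset_opairs by (fastforce simp: w'_def)
  qed (simp add: finite_opairs)
  have G: "GF (\<lambda>y. w' (abc, y)) (D b \<times> restr k (Suc m) j) = q ^ sh abc * (r b * GF wt (restr k
      (Suc m) j))" for abc b j
  proof -
    have "(\<lambda>y. w' (abc, y)) = (\<lambda>y. sh abc + (case y of (s, x) \<Rightarrow> s * (2*m+1) + wt x))"
      by (auto simp: w'_def)
    then show ?thesis
      unfolding GD [symmetric] using finD finite_wt[OF restr_subset_opairs] by (simp add:
          GF_shift GF_times)
  qed
  have dom: "restr_dom k m i = (SIGMA abc : (SIGMA a:UNIV. {..<i - of_bool a} \<times> UNIV).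
     D (fst (snd abc)) \<times> restr k (Suc m) (k - fst (snd abc) - of_bool (snd (snd abc))))"
    unfolding restr_dom_def D_def by (auto split: prod.splits)
  have "GF wt (restr k m i) = GF w' (restr_dom k m i)"
  proof (rule GF_bij [OF bij_glue, symmetric])
    fix x assume "x \<in> restr_dom k m i"
    obtain a b c s U V where x: "x = ((a, b, c), s, U, V)"
      by (rule glue_arg_cases)
    have "(U, V) \<in> restr k (Suc m) (k - b - of_bool c)"
      using \<open>x \<in> restr_dom k m i\<close> by (auto simp: restr_dom_def x)
    then have V: "finite V" "2*m+1 \<notin> V" "2*m+2 \<notin> V"
      by (force simp: restr_def)+
    have "\<Sum>(V \<union> (if a then {2*m+1} else {}) \<union> (if c then {2*m+2} else {})) =
       \<Sum>V + (2*m+1) * of_bool a + (2*m+2) * of_bool c"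
      using V by (cases a; cases c) auto
    then show "wt (glue m x) = w' x"
      by (simp add: x glue_def wt_def w'_def sh_def sum_mset_replicate_mset algebra_simps)
  qed
  also have "\<dots> = (\<Sum>abc\<in>(SIGMA a:UNIV. {..<i - of_bool a} \<times> UNIV).
     q ^ sh abc * (r (fst (snd abc)) * GF wt (restr k (Suc m) (k - fst (snd abc) - of_bool (snd
         (snd abc))))))"
    unfolding dom by (subst GF_Sigma) (auto simp: G fin)
  also have "\<dots> = (\<Sum>a\<in>UNIV. \<Sum>bc\<in>{..<i - of_bool a} \<times> UNIV.
     q ^ sh (a, bc) * (r (fst bc) * GF wt (restr k (Suc m) (k - fst bc - of_bool (snd bc)))))"
    by (subst sum.Sigma) (auto intro!: sum.cong)
  also have "\<dots> = (\<Sum>a\<in>UNIV. \<Sum>b<i - of_bool a. \<Sum>c\<in>UNIV.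
     q ^ sh (a, b, c) * (r b * GF wt (restr k (Suc m) (k - b - of_bool c))))"
    by (simp add: sum.cartesian_product case_prod_unfold)
  also have "\<dots> = (\<Sum>a\<in>UNIV. \<Sum>b<i - of_bool a. q ^ ((2*m+1) * of_bool a) * restr_step k m b)"
  proof (intro sum.cong refl)
    fix a b
    have "q ^ sh (a, b, c) = q ^ ((2*m+1) * of_bool a) * q ^ ((2*m+2)*b) * q ^ ((2*m+2) *
        of_bool c)" for c
      by (simp add: sh_def flip: power_add add: algebra_simps)
    moreover have "restr_step k m b = q ^ ((2*m+2)*b) * (r b *
        (GF wt (restr k (Suc m) (k - b)) + q ^ (2*m+2) * GF wt (restr k (Suc m) (k - b - 1))))"
      unfolding restr_step_def r_def ..
    ultimately show "(\<Sum>c\<in>UNIV. q ^ sh (a, b, c) * (r b * GF wt (restr k (Suc m) (k - b - of_bool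
        c)))) =
       q ^ ((2*m+1) * of_bool a) * restr_step k m b"
      by (simp add: UNIV_bool distrib_left mult_ac del: power_Suc mult_Suc mult_Suc_right) simp
  qed
  also have "\<dots> = (\<Sum>b<i. restr_step k m b) + q ^ (2*m+1) * (\<Sum>b<i - 1. restr_step k m b)"
    by (simp add: UNIV_bool sum_distrib_left del: power_Suc)
  finally show ?thesis .
qed

section \<open>Comparison of the restricted overpartitions with the explicit solution\<close>

lemma GF_restr_base:
  assumes "1 \<le> i" "i \<le> k"
  shows "near1 (2 * int m + 1) (GF wt (restr k m i))"
  unfolding ord_ge_def
proof (intro allI impI)
  fix n :: int assume n: "n < 2 * int m + 1"
  show "fls_nth (GF wt (restr k m i) - 1) n = 0"
  proof (cases "n \<ge> 0")
    case True
    define l where "l = nat n"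
    have u: "x = ({#}, {})" if "x \<in> restr k m i" "wt x = l" for x
    proof -
      obtain U V where x: "x = (U, V)" by (cases x)
      have "U = {#}"
      proof (rule ccontr)
        assume "U \<noteq> {#}"
        then obtain t where "t \<in># U" by auto
        then show False
          using that member_le_sum_mset[of t U] n True by (fastforce simp: restr_def x wt_def l_def)
      qed
      moreover have "V = {}"
      proof (rule ccontr)
        assume "V \<noteq> {}"
        then obtain t where "t \<in> V" by auto
        then show False
          using that member_le_Sum[of V t] n True by (fastforce simp: restr_def x wt_def l_def)
      qed
      ultimately show ?thesis by (simp add: x)
    qed
    have e: "({#}, {}) \<in> restr k m i"
      using assms by (simp add: restr_def)
    have w: "wt ({#}, {}) = 0"
      by (simp add: wt_def)
    have "x \<in> restr k m i \<and> wt x = l \<longleftrightarrow> x = ({#}, {}) \<and> l = 0" for x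
    proof
      assume x: "x \<in> restr k m i \<and> wt x = l"
      with u have "x = ({#}, {})" by blast
      with x w show "x = ({#}, {}) \<and> l = 0" by metis
    qed (use e w in metis)
    then have "{x \<in> restr k m i. wt x = l} = (if l = 0 then {({#}, {})} else {})"
      by auto
    moreover have "n = int l" using True by (simp add: l_def)
    ultimately show ?thesis
      by (simp add: GF_nth)
  qed (simp add: GF_def)
qed

text \<open>The delicate case is \<open>b = k - 1\<close>. There no non-overlined
  \<open>2m+1\<close> is allowed and the second summand is empty; on the other side
  \<open>C_0 = -C_1/q\<close> turns \<open>C_1 + xp C_0\<close> into \<open>(1 - xq) C_1\<close>,
  which cancels the denominator.\<close>

lemma restr_step_approx:
  assumes IH: "\<And>i. 1 \<le> i \<Longrightarrow> i \<le> k \<Longrightarrow> ord_ge N (GF wt (restr k (Suc m) i) - gordon_sum k M L (Suc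
      m) (int i))"
    and b: "b < k"
  shows "ord_ge N (restr_step k m b - gordon_step k M L m b)"
proof (cases "b + 2 \<le> k")
  case True
  have 1: "int k - int b = int (k - b)" "int (k - b) - 1 = int (k - b - 1)"
    using True by auto
  have "restr_step k m b - gordon_step k M L m b = q ^ ((2*m+2)*b) * ((GF wt (restr k (Suc m) (k
      - b)) - gordon_sum k M L (Suc m) (int (k - b)))
     + q ^ (2*m+2) * (GF wt (restr k (Suc m) (k - b - 1)) - gordon_sum k M L (Suc m) (int (k - b
         - 1)))) / (1 - q ^ (2*m+1))"
    using True unfolding restr_step_def gordon_step_def 1
    by (simp add: diff_divide_distrib [symmetric] del: power_Suc) (simp add: algebra_simps)
  also have "ord_ge N \<dots>"
    using True b by (intro ord_ge_divide_near1 near1_1_minus ord_ge_mult_left ord_ge_add IH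
        ord_ge_q_power) auto
  finally show ?thesis .
next
  case False
  then have k: "k - b = 1" "int k - int b = 1" using b by auto
  have "gordon_sum k M L (Suc m) 1 + q ^ (2*m+2) * gordon_sum k M L (Suc m) 0 = (1 - q ^
      (2*m+1)) * gordon_sum k M L (Suc m) 1"
    by (simp add: gordon_sum_zero algebra_simps)
  then have "gordon_step k M L m b = q ^ ((2*m+2)*b) * gordon_sum k M L (Suc m) 1"
    unfolding gordon_step_def k using one_minus_q_nonzero[of "2*m+1"] by (simp del:
        one_minus_q_nonzero)
  moreover have "restr_step k m b = q ^ ((2*m+2)*b) * GF wt (restr k (Suc m) 1)"
    using False unfolding restr_step_def k by simp
  ultimately have "restr_step k m b - gordon_step k M L m b = q ^ ((2*m+2)*b) * (GF wt (restr k
      (Suc m) 1) - gordon_sum k M L (Suc m) (int 1))"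
    by (simp add: right_diff_distrib)
  also have "ord_ge N \<dots>"
    using b by (intro ord_ge_mult_left IH ord_ge_q_power) auto
  finally show ?thesis .
qed

text \<open>Downward induction from \<open>m = M\<close>, where both series are 1 up to order
  \<open>N\<close>. Both satisfy the same recurrence, exactly or up to order \<open>L - 1\<close>,
  and its coefficients have no negative powers, so the accuracy is preserved.\<close>

lemma GF_restr_approx:
  assumes "m \<le> M" "N \<le> int M" "N \<le> int L - 1"
  shows "1 \<le> i \<Longrightarrow> i \<le> k \<Longrightarrow> ord_ge N (GF wt (restr k m i) - gordon_sum k M L m (int i))"
  using assms(1)
proof (induction m arbitrary: i rule: inc_induct)
  case base
  have "ord_ge N (GF wt (restr k M i) - 1)"
    by (rule ord_ge_mono[OF GF_restr_base]) (use base assms in auto)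
  moreover have "ord_ge N (gordon_sum k M L M (int i) - 1)"
    by (rule ord_ge_mono[OF gordon_sum_base]) (use base assms in auto)
  ultimately show ?case
    using ord_ge_diff by fastforce
next
  case (step m)
  obtain j where j: "i = Suc j" using step.prems by (cases i) auto
  have 1: "ord_ge N (gordon_sum k M L m (int (Suc j)) -
     ((\<Sum>b<Suc j. gordon_step k M L m b) + q ^ (2*m+1) * (\<Sum>b<j. gordon_step k M L m b)))"
    by (rule ord_ge_mono[OF gordon_sum_sum_approx]) (use step.prems assms j in auto)
  have 2: "ord_ge N ((\<Sum>b<Suc j. restr_step k m b - gordon_step k M L m b) + q ^ (2*m+1) * (\<Sum>b<j.
      restr_step k m b - gordon_step k M L m b))"
    using step.prems j
    by (intro ord_ge_add ord_ge_mult_left ord_ge_sum restr_step_approx step.IH ord_ge_q_power) auto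
  have "ord_ge N ((\<Sum>b<Suc j. restr_step k m b - gordon_step k M L m b) + q ^ (2*m+1) * (\<Sum>b<j.
      restr_step k m b - gordon_step k M L m b)
    - (gordon_sum k M L m (int (Suc j)) - ((\<Sum>b<Suc j. gordon_step k M L m b) + q ^ (2*m+1) *
        (\<Sum>b<j. gordon_step k M L m b))))"
    by (rule ord_ge_diff[OF 2 1])
  then show ?case
    unfolding GF_restr_recurrence unfolding j diff_Suc_1 sum_subtractf
    by (simp add: algebra_simps del: power_Suc sum.lessThan_Suc of_nat_Suc)
qed

subsection \<open>Products\<close>

lemma finite_multisets_sum:
  assumes "0 \<notin> A"
  shows "finite {U \<in> {U. set_mset U \<subseteq> A}. sum_mset U = (n::nat)}"
  by (rule finite_subset[OF _ finite_partitions[of n]]) (use assms in \<open>auto simp: partitions_def\<close>)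

text \<open>Each new size \<open>t\<close> splits off its multiplicity as an independent natural
  number, a geometric series.\<close>

lemma GF_multisets:
  assumes "finite A" "0 \<notin> A"
  shows "GF sum_mset {U. set_mset U \<subseteq> A} = (\<Prod>t\<in>A. 1 / (1 - q ^ t))"
  using assms
proof (induction A rule: finite_induct)
  case empty
  have "{U :: nat multiset. set_mset U \<subseteq> {}} = {{#}}" by auto
  then show ?case by (simp add: GF_singleton)
next
  case (insert t A)
  have t: "t > 0" and A: "0 \<notin> A" using insert.prems by auto
  have fin: "finite {s \<in> UNIV. s * t = n}" for n
    by (rule finite_subset[of _ "{..n}"]) (use t in auto)
  have zero: "count U t = 0" if "set_mset U \<subseteq> A" for U
    using that insert.hyps by (auto simp: count_eq_zero_iff)
  have "bij_betw (\<lambda>(s, U). U + replicate_mset s t) (UNIV \<times> {U. set_mset U \<subseteq> A}) {U. set_mset U \<subseteq>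
      insert t A}"
  proof (rule bij_betw_byWitness[where f' = "\<lambda>U. (count U t, filter_mset (\<lambda>x. x \<noteq> t) U)"])
    show "\<forall>x\<in>UNIV \<times> {U. set_mset U \<subseteq> A}. (\<lambda>U. (count U t, filter_mset (\<lambda>x. x \<noteq> t) U))
        ((\<lambda>(s, U). U + replicate_mset s t) x) = x"
      by (auto simp: zero intro!: multiset_eqI)
    show "\<forall>U\<in>{U. set_mset U \<subseteq> insert t A}. (\<lambda>(s, U). U + replicate_mset s t)
        (count U t, filter_mset (\<lambda>x. x \<noteq> t) U) = U"
      by (auto intro!: multiset_eqI)
  qed (auto split: if_splits)
  then have "GF sum_mset {U. set_mset U \<subseteq> insert t A} =
      GF (\<lambda>(s, U). s * t + sum_mset U) (UNIV \<times> {U. set_mset U \<subseteq> A})"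
    by (intro GF_bij [symmetric]) (auto simp: sum_mset_replicate_mset)
  also have "\<dots> = 1 / (1 - q ^ t) * (\<Prod>t\<in>A. 1 / (1 - q ^ t))"
    using insert.IH[OF A] fin finite_multisets_sum[OF A] GF_multiples[OF t] by (simp add: GF_times)
  finally show ?case using insert.hyps by simp
qed

lemma GF_subsets:
  assumes "finite B"
  shows "GF \<Sum> (Pow B) = (\<Prod>t\<in>B. 1 + q ^ t)"
  using assms
proof (induction B rule: finite_induct)
  case empty
  show ?case by (simp add: GF_singleton)
next
  case (insert t B)
  have "bij_betw (\<lambda>(b, V). if b then insert t V else V) (UNIV \<times> Pow B) (Pow (insert t B))"
  proof (rule bij_betw_byWitness[where f' = "\<lambda>V. (t \<in> V, V - {t})"])
    show "\<forall>x\<in>UNIV \<times> Pow B. (\<lambda>V. (t \<in> V, V - {t})) ((\<lambda>(b, V). if b then insert t V else V) x) = x"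
      using insert.hyps by auto
  qed (auto split: if_splits)
  then have "GF \<Sum> (Pow (insert t B)) = GF (\<lambda>(b, V). (if b then t else 0) + \<Sum>V) (UNIV \<times> Pow B)"
  proof (rule GF_bij [symmetric])
    fix x assume "x \<in> (UNIV :: bool set) \<times> Pow B"
    then obtain b V where x: "x = (b, V)" and V: "V \<subseteq> B" by blast
    have "finite V" "t \<notin> V"
      using V insert.hyps finite_subset[of V B] by auto
    then show "\<Sum>((\<lambda>(b, V). if b then insert t V else V) x) = (\<lambda>(b, V). (if b then t else 0) + \<Sum>V) x"
      by (simp add: x)
  qed
  also have "\<dots> = GF (\<lambda>b. if b then t else 0) UNIV * GF \<Sum> (Pow B)"
    by (rule GF_times) (use insert.hyps in auto)
  also have "GF (\<lambda>b. if b then t else 0) UNIV = 1 + q ^ t"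
  proof -
    \<comment> \<open>The dummy unit component puts the two-element sum in the form required by
      \<open>GF_Sigma\<close>.\<close>
    have "bij_betw fst ((UNIV :: bool set) \<times> {()}) UNIV"
      by (auto simp: bij_betw_def inj_on_def)
    then have "GF (\<lambda>b. if b then t else 0) UNIV = GF (\<lambda>x. if fst x then t else 0) (UNIV \<times> {()})"
      by (rule GF_bij [symmetric]) auto
    also have "\<dots> = (\<Sum>b\<in>UNIV. GF (\<lambda>y. if b then t else 0) {()})"
      by (subst GF_Sigma) auto
    also have "\<dots> = 1 + q ^ t"
      using GF_shift[of t "\<lambda>_. 0" "{()}"] by (simp add: UNIV_bool GF_singleton)
    finally show ?thesis .
  qed
  finally show ?case using insert by simp
qed

lemma GF_pairs:
  assumes "finite A" "finite B" "0 \<notin> A"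
  shows "GF wt ({U. set_mset U \<subseteq> A} \<times> Pow B) = (\<Prod>t\<in>A. 1 / (1 - q ^ t)) * (\<Prod>t\<in>B. 1 + q ^ t)"
  unfolding wt_def GF_multisets[OF assms(1,3), symmetric] GF_subsets[OF assms(2), symmetric]
  by (rule GF_times) (use assms finite_multisets_sum in auto)

section \<open>The theta series as a product over residue classes\<close>

lemma over_prod_div_odd_prod: "over_prod M / odd_prod M = (\<Prod>t\<in>{1..2*M}. 1 + q ^ t) /
    (\<Prod>t\<in>{1..2*M}. 1 - q ^ t)"
proof (induction M)
  case 0
  show ?case by (simp add: over_prod_def odd_prod_def)
next
  case (Suc M)
  have p: "prod f {1..2 * Suc M} = prod f {1..2*M} * f (2*M+1) * f (2*M+2)" for f :: "nat \<Rightarrow> rat fls"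
    by simp
  have h: "g * (a * b / c) / (d * e) = g / d * (a * b) / (e * c)" for a b c d e g :: "rat fls"
    by simp
  have h': "a / b * (c * d) / (e * f) = a * c * d / (b * e * f)" for a b c d e f :: "rat fls"
    by (simp add: mult.assoc)
  show ?case
    unfolding over_prod_Suc odd_prod_Suc p h Suc.IH h' ..
qed

text \<open>Jacobi's identity with \<open>r = 2k - 1\<close> and \<open>c = 2i - 1\<close>, the
  bilateral sum being folded at its centre \<open>s = R\<close>.\<close>

lemma theta_approx:
  assumes "1 \<le> i" "i \<le> k"
  shows "ord_ge (int R) ((\<Sum>n\<le>R. (-1) ^ n *
     (q powi ((2 * int k - 1) * int n * int n + 2 * (int k - int i) * int n)
      - q powi ((2 * int k - 1) * (int n + 1) * (int n + 1) - 2 * (int k - int i) * (int n + 1))))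
    - (\<Prod>j<R. (1 - q ^ (2*i-1 + 2*(2*k-1)*j)) * (1 - q ^ (2*(2*k-1)*(j+1) - (2*i-1))) * (1 - q ^
        (2*(2*k-1)*(j+1)))))"
proof -
  define f where "f s = (-1) ^ (R + s) *
        q powi (int (2*k-1) * (int s - int R) * (int s - int R - 1) + int (2*i-1) * (int s - int
            R))" for s
  define e2 where "e2 n = (2 * int k - 1) * (int n + 1) * (int n + 1) - 2 * (int k - int i) *
      (int n + 1)" for n
  have r: "int (2*k-1) = 2 * int k - 1" "int (2*i-1) = 2 * int i - 1"
    using assms by auto
  have f1: "f (R - n) = (-1) ^ n * q powi ((2 * int k - 1) * int n * int n + 2 * (int k - int i)
      * int n)" if "n \<le> R" for n
  proof -
    have "int (R - n) - int R = - int n" using that by simp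
    moreover have "(-1) ^ (R + (R - n)) = ((-1) ^ n :: rat fls)"
    proof -
      have "even (R + (R - n)) \<longleftrightarrow> even n" using that by presburger
      then show ?thesis by (simp add: uminus_power_if)
    qed
    ultimately show ?thesis
      unfolding f_def r by (simp add: algebra_simps)
  qed
  have f2: "f (R + 1 + n) = - ((-1) ^ n * q powi e2 n)" for n
  proof -
    have "int (R + 1 + n) - int R = int n + 1" by simp
    moreover have "(-1) ^ (R + (R + 1 + n)) = (- ((-1) ^ n) :: rat fls)"
      by (simp add: power_add)
    ultimately show ?thesis
      unfolding f_def r e2_def by (simp add: algebra_simps)
  qed
  have "(\<Sum>s\<le>2*R. f s) = (\<Sum>s\<le>R. f s) + (\<Sum>s=R+1..2*R. f s)"
    using sum_up_index_split[of f R R] by (simp add: mult_2)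
  also have "(\<Sum>s\<le>R. f s) = (\<Sum>n\<le>R. f (R - n))"
    by (rule sum.reindex_bij_witness[of _ "\<lambda>n. R - n" "\<lambda>n. R - n"]) auto
  also have "(\<Sum>s=R+1..2*R. f s) = (\<Sum>n<R. f (R + 1 + n))"
    by (rule sum.reindex_bij_witness[of _ "\<lambda>n. R + 1 + n" "\<lambda>s. s - R - 1"]) auto
  finally have F0: "(\<Sum>s\<le>2*R. f s) = (\<Sum>n\<le>R. f (R - n)) + (\<Sum>n<R. f (R + 1 + n))" .
  have F: "(\<Sum>s\<le>2*R. f s) = (\<Sum>n\<le>R. (-1) ^ n * q powi ((2 * int k - 1) * int n * int n + 2 * (int
      k - int i) * int n))
     - (\<Sum>n<R. (-1) ^ n * q powi e2 n)"
    unfolding F0 f2 sum_negf by (simp add: f1)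
  \<comment> \<open>Above the centre there are only \<open>R\<close> indices, so the second family
    has one surplus term, \<open>n = R\<close>, which is of high order.\<close>
  have G: "(\<Sum>n\<le>R. (-1) ^ n * (q powi ((2 * int k - 1) * int n * int n + 2 * (int k - int i) *
      int n) - q powi e2 n))
     = (\<Sum>s\<le>2*R. f s) - (-1) ^ R * q powi e2 R"
    unfolding F by (simp add: right_diff_distrib sum_subtractf lessThan_Suc_atMost [symmetric])
  have "int R \<le> e2 R"
  proof -
    define x where "x = int R + 1"
    have x: "x \<ge> 1" by (simp add: x_def)
    have "e2 R = x * ((2 * int k - 1) * x - 2 * (int k - int i))"
      by (simp add: e2_def x_def algebra_simps)
    also have "\<dots> \<ge> x * 1"
    proof (rule mult_left_mono)
      define y where "y = (2 * int k - 1) * x"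
      have "2 * int k - 1 \<le> y"
        using mult_left_mono[of 1 x "2 * int k - 1"] x assms by (simp add: y_def)
      then show "1 \<le> (2 * int k - 1) * x - 2 * (int k - int i)"
        unfolding y_def [symmetric] using assms(1) by simp
    qed (use x in simp)
    finally show ?thesis by (simp add: x_def)
  qed
  then have 1: "ord_ge (int R) ((-1) ^ R * q powi e2 R)"
    by (intro ord_ge_mult_left ord_ge_neg_one_power ord_ge_q_powi)
  have 2: "ord_ge (int R) ((\<Sum>s\<le>2*R. f s) -
    (\<Prod>j<R. (1 - q ^ (2*i-1 + 2*(2*k-1)*j)) * (1 - q ^ (2*(2*k-1)*(j+1) - (2*i-1))) * (1 - q ^
        (2*(2*k-1)*(j+1)))))"
    unfolding f_def by (rule ord_ge_mono[OF Jacobi_triple_approx]) (use assms in auto)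
  have "ord_ge (int R) ((\<Sum>s\<le>2*R. f s) -
    (\<Prod>j<R. (1 - q ^ (2*i-1 + 2*(2*k-1)*j)) * (1 - q ^ (2*(2*k-1)*(j+1) - (2*i-1))) * (1 - q ^
        (2*(2*k-1)*(j+1))))
     - (-1) ^ R * q powi e2 R)"
    by (rule ord_ge_diff[OF 2 1])
  then show ?thesis
    unfolding e2_def [symmetric] G by (simp only: diff_diff_eq add.commute)
qed

text \<open>Every block of \<open>2r\<close> consecutive integers contributes three factors.
  Strictness of \<open>c < r\<close> keeps the three residues distinct; at \<open>c = r\<close> two
  of them coincide, so \<open>i = k\<close> is treated separately.\<close>

lemma prod_bad_residues:
  fixes f :: "nat \<Rightarrow> 'a::comm_monoid_mult"
  assumes "1 \<le> c" "c < r"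
  shows "(\<Prod>t\<in>{t\<in>{1..2*r*R}. t mod (2*r) \<in> {0, c, 2*r-c}}. f t) =
     (\<Prod>j<R. f (c + 2*r*j) * f (2*r*(j+1) - c) * f (2*r*(j+1)))"
proof (induction R)
  case 0
  show ?case by simp
next
  case (Suc R)
  have e: "{t\<in>{1..2*r*Suc R}. t mod (2*r) \<in> {0, c, 2*r-c}} =
     {t\<in>{1..2*r*R}. t mod (2*r) \<in> {0, c, 2*r-c}} \<union> {c + 2*r*R, 2*r*(R+1) - c, 2*r*(R+1)}" (is
         "?A = ?B \<union> ?C")
  proof (intro equalityI subsetI)
    fix t assume t: "t \<in> ?A"
    show "t \<in> ?B \<union> ?C"
    proof (cases "t \<le> 2*r*R")
      case False
      define s where "s = t - 2*r*R"
      have s: "t = 2*r*R + s" "1 \<le> s" "s \<le> 2*r"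
        using False t by (auto simp: s_def)
      have "t mod (2*r) = s mod (2*r)" by (simp add: s)
      then have "s = 2*r \<or> s = c \<or> s = 2*r - c"
        using t s by (cases "s = 2*r") auto
      then show ?thesis using assms s by auto
    qed (use t in auto)
  next
    fix t assume "t \<in> ?B \<union> ?C"
    moreover have "2*r*(R+1) - c = 2*r*R + (2*r - c)"
      using assms by simp
    moreover have "(2*r*R + (2*r - c)) mod (2*r) = 2*r - c"
      using assms by (simp only: mod_mult_self4) simp
    moreover have "(c + 2*r*R) mod (2*r) = c"
      using assms by simp
    ultimately show "t \<in> ?A"
      using assms by auto
  qed
  have d: "?B \<inter> ?C = {}"
    using assms by auto
  have "prod f ?A = prod f ?B * prod f ?C"
    unfolding e by (rule prod.union_disjoint[OF _ _ d]) simp_all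
  moreover have "prod f ?C = f (c + 2*r*R) * f (2*r*(R+1) - c) * f (2*r*(R+1))"
    using assms by (simp add: mult.assoc)
  ultimately show ?case
    unfolding Suc.IH by (simp add: mult.assoc)
qed

lemma ord_ge_imp_card_eq:
  assumes "ord_ge (int n + 1) (GF w A - GF v B)"
  shows "card {x \<in> A. w x = n} = card {x \<in> B. v x = n}"
proof -
  have "fls_nth (GF w A - GF v B) (int n) = 0"
    using assms by (simp add: ord_ge_def)
  then show ?thesis by (simp add: GF_nth)
qed

lemma GF_restr_product_approx:
  assumes "1 \<le> i" "i \<le> k"
  shows "ord_ge (int R - 1) (GF wt (restr k 0 i) -
    (\<Prod>t\<in>{1..2*(2*k-1)*R}. 1 + q ^ t) / (\<Prod>t\<in>{1..2*(2*k-1)*R}. 1 - q ^ t) *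
    (\<Prod>j<R. (1 - q ^ (2*i-1 + 2*(2*k-1)*j)) * (1 - q ^ (2*(2*k-1)*(j+1) - (2*i-1))) * (1 - q ^
        (2*(2*k-1)*(j+1)))))"
proof -
  \<comment> \<open>With this cut-off, \<open>{1..2*M}\<close> consists of exactly \<open>R\<close>
    full blocks of length \<open>2(2k-1)\<close>.\<close>
  define M where "M = (2*k-1)*R"
  define F where "F = over_prod M / odd_prod M"
  define Z where "Z = (\<Prod>j<R. (1 - q ^ (2*i-1 + 2*(2*k-1)*j)) * (1 - q ^ (2*(2*k-1)*(j+1) -
      (2*i-1))) * (1 - q ^ (2*(2*k-1)*(j+1))))"
  define th where "th = (\<Sum>n\<le>R. (-1) ^ n *
     (q powi ((2 * int k - 1) * int n * int n + 2 * (int k - int i) * int n)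
      - q powi ((2 * int k - 1) * (int n + 1) * (int n + 1) - 2 * (int k - int i) * (int n + 1))))"
  have "1 * R \<le> (2*k-1)*R"
    using assms by (intro mult_right_mono) auto
  then have M: "R \<le> M" by (simp add: M_def)
  have 1: "ord_ge (int R - 1) (GF wt (restr k 0 i) - gordon_sum k M R 0 (int i))"
    by (rule GF_restr_approx) (use M assms in auto)
  have "ord_ge (int R) (F * (th - Z))"
  proof (rule ord_ge_mult_left)
    show "ord_ge 0 F"
      unfolding F_def by (rule near1_imp_ord_ge[of 1]) (auto intro: near1_divide near1_over_prod
          near1_odd_prod)
    show "ord_ge (int R) (th - Z)"
      unfolding th_def Z_def by (rule theta_approx[OF assms])
  qed
  then have "ord_ge (int R - 1) (gordon_sum k M R 0 (int i) - F * Z)"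
    unfolding gordon_sum_at_0 F_def [symmetric] th_def [symmetric] right_diff_distrib [symmetric]
    by (rule ord_ge_mono) simp
  from ord_ge_add[OF 1 this] have "ord_ge (int R - 1) (GF wt (restr k 0 i) - F * Z)"
    by simp
  moreover have "2 * M = 2*(2*k-1)*R" by (simp add: M_def)
  ultimately show ?thesis
    unfolding F_def over_prod_div_odd_prod Z_def by simp
qed

section \<open>From the two counts to coefficients of generating functions\<close>

lemma O_num_conv:
  assumes "i \<le> k"
  shows "O_num k i n = card {x \<in> restr k 0 i. wt x = n}"
proof -
  define Q where "Q u V \<longleftrightarrow> of_bool (1 \<in> V) + u 2 < i \<and>
     (\<forall>t>0. of_bool (2*t \<in> V) + u (2*t) + of_bool (2*t+1 \<in> V) + u (2*t+2) < k) \<and>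
     (\<forall>t. u (2*t+1) \<ge> 1 \<longrightarrow> u (2*t+2) + 2 \<le> k)" for u :: "nat \<Rightarrow> nat" and V :: "nat set"
  have f: "f_over l t = of_bool (t \<in> snd l)" for l t
    by (simp add: f_over_def)
  have "O_set k i n = {l \<in> overpartitions n. Q (f_non l) (snd l)}"
    unfolding O_set_def
  proof (rule Collect_cong, rule conj_cong[OF refl])
    fix l assume l: "l \<in> overpartitions n"
    have A: "int (f_over l 1 + f_non l 2) \<le> int i - 1 \<longleftrightarrow> of_bool (1 \<in> snd l) + f_non l 2 < i"
      unfolding f by linarith
    have B: "int (f_over l (2*t) + f_non l (2*t) + f_over l (2*t+1) + f_non l (2*t+2)) \<le> int k - 1 \<longleftrightarrow>
       of_bool (2*t \<in> snd l) + f_non l (2*t) + of_bool (2*t+1 \<in> snd l) + f_non l (2*t+2) < k" for t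
      unfolding f by linarith
    have C: "int (f_non l (2*t+2)) \<le> int k - 2 \<longleftrightarrow> f_non l (2*t+2) + 2 \<le> k" for t
      by linarith
    have z: "0 \<notin> snd l" "f_non l 0 = 0"
      using f_over_0[OF l] f_non_0[OF l] by (auto simp: f)
    have split: "(\<forall>t::nat. R t) \<longleftrightarrow> R 0 \<and> (\<forall>t>0. R t)" for R
      by (metis gr0I)
    \<comment> \<open>Since 0 is not a part, condition (2) at \<open>t = 0\<close> is condition (1)
      with \<open>k\<close> in place of \<open>i\<close>, and so follows from it by
      \<open>i \<le> k\<close>.\<close>
    have Z: "of_bool (2*0 \<in> snd l) + f_non l (2*0) + of_bool (2*0+1 \<in> snd l) + f_non l (2*0+2) < k \<longleftrightarrow>
       of_bool (1 \<in> snd l) + f_non l 2 < k"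
      using z by (simp add: eval_nat_numeral)
    have "of_bool (1 \<in> snd l) + f_non l 2 < i \<longrightarrow> of_bool (1 \<in> snd l) + f_non l 2 < k"
      using assms by linarith
    then show "(int (f_over l 1 + f_non l 2) \<le> int i - 1 \<and>
     (\<forall>t. int (f_over l (2*t) + f_non l (2*t) + f_over l (2*t+1) + f_non l (2*t+2)) \<le> int k - 1) \<and>
     (\<forall>t. f_non l (2*t+1) \<ge> 1 \<longrightarrow> int (f_non l (2*t+2)) \<le> int k - 2)) \<longleftrightarrow> Q (f_non l) (snd l)"
      unfolding A B C Q_def
        split[of "\<lambda>t. of_bool (2*t \<in> snd l) + f_non l (2*t) + of_bool (2*t+1 \<in> snd l) + f_non l
            (2*t+2) < k"] Z
      by blast
  qed
  then have "O_num k i n = card {x \<in> opairs. Q (count (fst x)) (snd x) \<and> wt x = n}"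
    by (simp add: O_num_def card_overpartitions)
  also have "{x \<in> opairs. Q (count (fst x)) (snd x) \<and> wt x = n} = {x \<in> restr k 0 i. wt x = n}"
  proof -
    have "x \<in> opairs \<and> Q (count (fst x)) (snd x) \<longleftrightarrow> x \<in> restr k 0 i" for x
    proof -
      obtain U V where x: "x = (U, V)" by (cases x)
      have e: "(\<forall>t\<in>#U. 2 * 0 < t) \<longleftrightarrow> 0 \<notin># U" "(\<forall>t\<in>V. 2 * 0 < t) \<longleftrightarrow> 0 \<notin> V"
        "2 * 0 + 1 = (1::nat)" "2 * 0 + 2 = (2::nat)"
        by (auto intro: gr0I)
      show ?thesis
        unfolding x opairs_def restr_def Q_def
        by (simp only: mem_Collect_eq prod.case fst_conv snd_conv e le0 simp_thms conj_ac)
    qed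
    then show ?thesis by blast
  qed
  finally show ?thesis .
qed

lemma opairs_bounded:
  assumes "x \<in> opairs" "wt x = n" "n \<le> T"
  shows "set_mset (fst x) \<subseteq> {1..T}" "snd x \<subseteq> {1..T}"
proof -
  obtain U V where x: "x = (U, V)" by (cases x)
  have *: "0 \<notin># U" "finite V" "0 \<notin> V" "sum_mset U + \<Sum>V = n"
    using assms by (auto simp: x opairs_def wt_def)
  have "1 \<le> t \<and> t \<le> T" if "t \<in># U" for t
    using that member_le_sum_mset[OF that] * assms(3) by (cases "t = 0") auto
  then show "set_mset (fst x) \<subseteq> {1..T}" by (auto simp: x)
  have "1 \<le> t \<and> t \<le> T" if "t \<in> V" for t
    using that member_le_Sum[OF *(2) that] * assms(3) by (cases "t = 0") auto
  then show "snd x \<subseteq> {1..T}" by (auto simp: x)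
qed

text \<open>Parts of an overpartition of \<open>n\<close> are at most \<open>T\<close>, so both
  components may be drawn from finite sets of sizes and the generating function becomes a finite
  product.\<close>

lemma P_num_conv:
  assumes S: "P_set k i n = {l \<in> overpartitions n. \<forall>t. (f_non l t \<ge> 1 \<longrightarrow> G t) \<and> (t \<in> snd l \<longrightarrow> H t)}"
    and n: "n \<le> T"
  shows "P_num k i n = card {x \<in> {U. set_mset U \<subseteq> {t\<in>{1..T}. G t}} \<times> Pow {t\<in>{1..T}. H t}. wt x = n}"
proof -
  define Q where "Q u V \<longleftrightarrow> (\<forall>t. (u t \<ge> 1 \<longrightarrow> G t) \<and> (t \<in> V \<longrightarrow> H t))" for u :: "nat \<Rightarrow> nat" and V ::
      "nat set"
  have "P_num k i n = card {x \<in> opairs. Q (count (fst x)) (snd x) \<and> wt x = n}"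
    unfolding P_num_def S using card_overpartitions[of n Q] by (simp add: Q_def)
  also have "{x \<in> opairs. Q (count (fst x)) (snd x) \<and> wt x = n} =
      {x \<in> {U. set_mset U \<subseteq> {t\<in>{1..T}. G t}} \<times> Pow {t\<in>{1..T}. H t}. wt x = n}" (is "?L = ?R")
  proof (intro equalityI subsetI)
    fix x assume x: "x \<in> ?L"
    obtain U V where UV: "x = (U, V)" by (cases x)
    have "set_mset U \<subseteq> {1..T}" "V \<subseteq> {1..T}"
      using opairs_bounded[of x n T] x n by (auto simp: UV)
    then show "x \<in> ?R"
      using x by (auto simp: UV Q_def)
  next
    fix x assume x: "x \<in> ?R"
    obtain U V where UV: "x = (U, V)" by (cases x)
    have "finite V"
      using x finite_subset[of V "{t\<in>{1..T}. H t}"] by (auto simp: UV)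
    moreover have "0 \<notin># U" "0 \<notin> V"
      using x by (auto simp: UV)
    moreover have "Q (count U) V"
      using x by (auto simp: UV Q_def)
    ultimately show "x \<in> ?L"
      using x by (simp add: UV opairs_def)
  qed
  finally show ?thesis .
qed

text \<open>The theta product consists of the factors \<open>1 - q^t\<close> with forbidden residue,
  which cancel from the denominator and leave the overlined parts unrestricted.\<close>

lemma P_product_less:
  assumes "1 \<le> c" "c < r"
  shows "GF wt ({U. set_mset U \<subseteq> {t\<in>{1..2*r*R}. t mod (2*r) \<notin> {0, c, 2*r-c}}} \<times> Pow
      {t\<in>{1..2*r*R}. True}) =
    (\<Prod>t\<in>{1..2*r*R}. 1 + q ^ t) / (\<Prod>t\<in>{1..2*r*R}. 1 - q ^ t) *
    (\<Prod>j<R. (1 - q ^ (c + 2*r*j)) * (1 - q ^ (2*r*(j+1) - c)) * (1 - q ^ (2*r*(j+1))))"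
proof -
  define A where "A = {t\<in>{1..2*r*R}. t mod (2*r) \<notin> {0, c, 2*r-c}}"
  define B where "B = {t\<in>{1..2*r*R}. t mod (2*r) \<in> {0, c, 2*r-c}}"
  have AB: "{1..2*r*R} = A \<union> B" "A \<inter> B = {}" "finite A" "finite B"
    by (auto simp: A_def B_def)
  have nz: "(\<Prod>t\<in>B. 1 - q ^ t) \<noteq> 0"
  proof -
    have "\<forall>t\<in>B. 1 - q ^ t \<noteq> 0"
      by (auto simp: B_def simp del: right_minus_eq intro!: one_minus_q_nonzero)
    then show ?thesis using AB(4) by (metis prod_zero_iff)
  qed
  have "(\<Prod>t\<in>{1..2*r*R}. 1 - q ^ t) = (\<Prod>t\<in>A. 1 - q ^ t) * (\<Prod>t\<in>B. 1 - q ^ t)"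
    unfolding AB(1) by (rule prod.union_disjoint) (use AB in auto)
  moreover have "(\<Prod>j<R. (1 - q ^ (c + 2*r*j)) * (1 - q ^ (2*r*(j+1) - c)) * (1 - q ^
      (2*r*(j+1)))) = (\<Prod>t\<in>B. 1 - q ^ t)"
    unfolding B_def by (rule prod_bad_residues[OF assms, symmetric])
  moreover have "GF wt ({U. set_mset U \<subseteq> A} \<times> Pow {t\<in>{1..2*r*R}. True}) =
     (\<Prod>t\<in>A. 1 / (1 - q ^ t)) * (\<Prod>t\<in>{t\<in>{1..2*r*R}. True}. 1 + q ^ t)"
    by (rule GF_pairs) (use AB in \<open>auto simp: A_def\<close>)
  moreover have "{t\<in>{1..2*r*R}. True} = {1..2*r*R}" by auto
  ultimately show ?thesis
    unfolding A_def [symmetric] using nz by (simp only: prod_dividef prod.neutral_const) simp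
qed

text \<open>A finite form of Euler's identity. At \<open>c = r\<close> each odd multiple of
  \<open>r\<close> occurs twice in the theta product: one copy cancels a denominator and the other
  combines with \<open>1 + a\<close> to \<open>1 - a^2\<close>. The step from \<open>R\<close> to
  \<open>R + 1\<close> multiplies both sides by \<open>(1 - a^2)(1 + b)\<close>.\<close>

lemma Euler_odd_distinct:
  assumes "r \<ge> 1"
  shows "(\<Prod>s\<in>{1..2*R}. (1 + q ^ (r*s)) / (1 - q ^ (r*s))) *
     (\<Prod>j<R. (1 - q ^ (r + 2*r*j)) * (1 - q ^ (2*r*(j+1) - r)) * (1 - q ^ (2*r*(j+1)))) =
     qfact (q ^ r) (2*R) / qfact (q ^ r) R"
proof (induction R)
  case 0
  show ?case by (simp add: qfact_def)
next
  case (Suc R)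
  define a where "a = q ^ (r*(2*R+1))"
  define b where "b = q ^ (r*(2*R+2))"
  have ab: "1 - a \<noteq> 0" "1 - b \<noteq> 0"
    unfolding a_def b_def using assms by (intro one_minus_q_nonzero; simp)+
  have p: "prod f {1..2 * Suc R} = prod f {1..2*R} * f (2*R+1) * f (2*R+2)" for f :: "nat \<Rightarrow> rat fls"
    by simp
  have e: "r + 2*r*R = r*(2*R+1)" "r*(2*R+2) - r = r*(2*R+1)" "2*r*(R+1) = r*(2*R+2)"
    using assms by (auto simp: algebra_simps)
  have Q: "qfact (q ^ r) (2 * Suc R) = qfact (q ^ r) (2*R) * (1 - a\<^sup>2) * (1 - b\<^sup>2)" "qfact (q ^
      r) (Suc R) = qfact (q ^ r) R * (1 - b)"
    unfolding a_def b_def qfact_q by (simp_all add: algebra_simps flip: power_mult)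
  have h: "x * ((1 + a) / (1 - a)) * ((1 + b) / (1 - b)) * (y * ((1 - a) * (1 - a) * (1 - b))) =
      x * y * ((1 - a\<^sup>2) * (1 + b))" for x y
  proof -
    have "x * (c / d) * (e / f) * (y * (d * d * f)) = x * y * (c * d * e)" if "d \<noteq> 0" "f \<noteq> 0"
      for c d e f :: "rat fls"
      using that by (simp add: field_simps)
    moreover have "1 - a\<^sup>2 = (1 + a) * (1 - a)"
      by (simp add: algebra_simps power2_eq_square)
    ultimately show ?thesis
      using ab by (simp only: mult.assoc)
  qed
  have h': "x * (1 - a\<^sup>2) * (1 - b\<^sup>2) / (y * (1 - b)) = x / y * ((1 - a\<^sup>2) * (1 + b))" for x y
  proof -
    have "1 - b\<^sup>2 = (1 + b) * (1 - b)" by (simp add: algebra_simps power2_eq_square)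
    then show ?thesis using ab(2) by simp
  qed
  show ?case
    unfolding p prod.lessThan_Suc e a_def [symmetric] b_def [symmetric] h Suc.IH Q h' ..
qed

text \<open>The multiples of \<open>r\<close> in the full product, times the theta product, give the
  tail quotient of Euler's identity, which is 1 up to high order. What remains are the sizes not
  divisible by \<open>r\<close>, for both kinds of parts.\<close>

lemma P_product_eq_approx:
  assumes "r \<ge> 1"
  shows "ord_ge (int R) ((\<Prod>t\<in>{1..2*r*R}. 1 + q ^ t) / (\<Prod>t\<in>{1..2*r*R}. 1 - q ^ t) *
    (\<Prod>j<R. (1 - q ^ (r + 2*r*j)) * (1 - q ^ (2*r*(j+1) - r)) * (1 - q ^ (2*r*(j+1))))
    - GF wt ({U. set_mset U \<subseteq> {t\<in>{1..2*r*R}. \<not> r dvd t}} \<times> Pow {t\<in>{1..2*r*R}. \<not> r dvd t}))"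
proof -
  define A where "A = {t\<in>{1..2*r*R}. \<not> r dvd t}"
  define B where "B = {t\<in>{1..2*r*R}. r dvd t}"
  define Z where "Z = (\<Prod>j<R. (1 - q ^ (r + 2*r*j)) * (1 - q ^ (2*r*(j+1) - r)) * (1 - q ^
      (2*r*(j+1))))"
  have AB: "{1..2*r*R} = A \<union> B" "A \<inter> B = {}" "finite A" "finite B"
    by (auto simp: A_def B_def)
  have B: "B = (\<lambda>s. r * s) ` {1..2*R}"
  proof (intro equalityI subsetI)
    fix t assume t: "t \<in> B"
    then obtain s where s: "t = r * s" by (auto simp: B_def)
    have "r * s \<le> r * (2 * R)" "s \<noteq> 0" using t by (auto simp: B_def s mult_ac intro: gr0I)
    then have "s \<in> {1..2*R}" using assms by auto
    then show "t \<in> (\<lambda>s. r * s) ` {1..2*R}" using s by blast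
  qed (use assms in \<open>auto simp: B_def\<close>)
  define X where "X = (\<Prod>t\<in>B. (1 + q ^ t) / (1 - q ^ t))"
  have X: "X = (\<Prod>s\<in>{1..2*R}. (1 + q ^ (r*s)) / (1 - q ^ (r*s)))"
    unfolding X_def B by (subst prod.reindex) (use assms in \<open>auto simp: inj_on_def\<close>)
  have G: "GF wt ({U. set_mset U \<subseteq> A} \<times> Pow A) = (\<Prod>t\<in>A. (1 + q ^ t) / (1 - q ^ t))"
    by (subst GF_pairs) (use AB in \<open>auto simp: A_def prod_dividef\<close>)
  have "(\<Prod>t\<in>{1..2*r*R}. 1 + q ^ t) / (\<Prod>t\<in>{1..2*r*R}. 1 - q ^ t) = (\<Prod>t\<in>{1..2*r*R}. (1 + q ^ t) /
      (1 - q ^ t))"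
    by (simp add: prod_dividef)
  also have "\<dots> = GF wt ({U. set_mset U \<subseteq> A} \<times> Pow A) * X"
    unfolding G X_def AB(1) by (rule prod.union_disjoint) (use AB in auto)
  finally have 1: "(\<Prod>t\<in>{1..2*r*R}. 1 + q ^ t) / (\<Prod>t\<in>{1..2*r*R}. 1 - q ^ t) = GF wt ({U. set_mset
      U \<subseteq> A} \<times> Pow A) * X" .
  have 2: "X * Z = qfact (q ^ r) (2*R) / qfact (q ^ r) R"
    unfolding X Z_def by (rule Euler_odd_distinct[OF assms])
  have "near1 (2 * int r * (int R + 1)) (X * Z)"
    unfolding 2 by (rule near1_qfact_quot[OF assms]) auto
  moreover have "1 * int R \<le> int r * (int R + 1)"
    using assms by (intro mult_mono) auto
  then have "int R \<le> 2 * int r * (int R + 1)" by simp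
  ultimately have "near1 (int R) (X * Z)" by (rule ord_ge_mono)
  then have "ord_ge (int R) (GF wt ({U. set_mset U \<subseteq> A} \<times> Pow A) * (X * Z - 1))"
    by (intro ord_ge_mult_left ord_ge_GF)
  then show ?thesis
    unfolding 1 A_def [symmetric] Z_def [symmetric] by (simp add: algebra_simps)
qed

text \<open>The modulus \<open>4k - 2\<close> is twice the odd number \<open>2k - 1\<close>, and
  \<open>-(2i-1)\<close> has the natural representative \<open>2(2k-1) - (2i-1)\<close>.\<close>

lemma P_set_less:
  assumes "1 \<le> i" "i < k"
  shows "P_set k i n = {l \<in> overpartitions n. \<forall>t. (f_non l t \<ge> 1 \<longrightarrow>
     t mod (2*(2*k-1)) \<notin> {0, 2*i-1, 2*(2*k-1) - (2*i-1)}) \<and> (t \<in> snd l \<longrightarrow> True)}"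
proof -
  define m where "m = 2*(2*k-1)"
  have m: "4 * int k - 2 = int m" "2 * int i - 1 = int (2*i-1)" "2*i-1 < m" "1 \<le> 2*i-1"
    using assms by (auto simp: m_def)
  have "[int t = 0] (mod int m) \<longleftrightarrow> t mod m = 0" for t
    by (metis cong_0_iff int_dvd_int_iff mod_eq_0_iff_dvd)
  moreover have "[int t = int (2*i-1)] (mod int m) \<longleftrightarrow> t mod m = 2*i-1" for t
    using m(3) unfolding cong_int_iff unfolding cong_def by simp
  moreover have "[int t = - int (2*i-1)] (mod int m) \<longleftrightarrow> t mod m = m - (2*i-1)" for t
  proof -
    have "[- int (2*i-1) = int (m - (2*i-1))] (mod int m)"
      using m(3) by (simp add: cong_iff_dvd_diff of_nat_diff)
    then have "[int t = - int (2*i-1)] (mod int m) \<longleftrightarrow> [int t = int (m - (2*i-1))] (mod int m)"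
      by (meson cong_sym cong_trans)
    also have "\<dots> \<longleftrightarrow> t mod m = m - (2*i-1)"
      using m(3,4) unfolding cong_int_iff unfolding cong_def by simp
    finally show ?thesis .
  qed
  ultimately show ?thesis
    using assms(2) unfolding P_set_def m_def [symmetric] m(1,2) by simp
qed

theorem theorem1p7:
  fixes k i n :: nat
  assumes "1 \<le> i" and "i \<le> k"
  shows "O_num k i n = P_num k i n"
proof -
  define r where "r = 2*k-1"
  define c where "c = 2*i-1"
  \<comment> \<open>The approximations are accurate to order \<open>R - 1 = n + 1\<close>, just
    enough to fix the coefficient of \<open>q^n\<close>.\<close>
  define R where "R = n + 2"
  define T where "T = 2*r*R"
  have r: "r \<ge> 1" "1 \<le> c" using assms by (auto simp: r_def c_def)
  have "1 * R \<le> 2*r*R" using r by (intro mult_right_mono) auto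
  then have n: "n \<le> T" by (simp add: T_def R_def)
  define Y where "Y = (\<Prod>t\<in>{1..T}. 1 + q ^ t) / (\<Prod>t\<in>{1..T}. 1 - q ^ t) *
    (\<Prod>j<R. (1 - q ^ (c + 2*r*j)) * (1 - q ^ (2*r*(j+1) - c)) * (1 - q ^ (2*r*(j+1))))"
  have W: "ord_ge (int n + 1) (GF wt (restr k 0 i) - Y)"
  proof -
    have "int R - 1 = int n + 1" by (simp add: R_def)
    then show ?thesis
      using GF_restr_product_approx[OF assms, of R] unfolding Y_def r_def c_def T_def by (simp
          only:)
  qed
  show ?thesis
  proof (cases "i < k")
    case True
    have "c < r" using True assms by (auto simp: c_def r_def)
    then have "Y = GF wt ({U. set_mset U \<subseteq> {t\<in>{1..T}. t mod (2*r) \<notin> {0, c, 2*r-c}}} \<times> Pow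
        {t\<in>{1..T}. True})"
      unfolding Y_def T_def by (rule P_product_less[OF r(2), symmetric])
    with W have "card {x \<in> restr k 0 i. wt x = n} =
        card {x \<in> {U. set_mset U \<subseteq> {t\<in>{1..T}. t mod (2*r) \<notin> {0, c, 2*r-c}}} \<times> Pow {t\<in>{1..T}.
            True}. wt x = n}"
      by (intro ord_ge_imp_card_eq) simp
    also have "\<dots> = P_num k i n"
      using P_num_conv[OF P_set_less[OF assms(1) True] n] unfolding c_def r_def by simp
    finally show ?thesis using O_num_conv[OF assms(2)] by simp
  next
    case False
    then have "i = k" using assms by simp
    then have "c = r" by (simp add: c_def r_def)
    define D where "D = {U. set_mset U \<subseteq> {t\<in>{1..T}. \<not> r dvd t}} \<times> Pow {t\<in>{1..T}. \<not> r dvd t}"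
    have "ord_ge (int n + 1) (Y - GF wt D)"
      using P_product_eq_approx[OF r(1), of R] unfolding Y_def D_def T_def \<open>c = r\<close>
      by (rule ord_ge_mono) (simp add: R_def)
    from ord_ge_add[OF W this] have "card {x \<in> restr k 0 i. wt x = n} = card {x \<in> D. wt x = n}"
      by (intro ord_ge_imp_card_eq) simp
    moreover have S: "P_set k i n = {l \<in> overpartitions n. \<forall>t. (f_non l t \<ge> 1 \<longrightarrow> \<not> r dvd t) \<and> (t
        \<in> snd l \<longrightarrow> \<not> r dvd t)}"
    proof -
      have "2 * int k - 1 = int r" using assms by (simp add: r_def)
      then show ?thesis
        unfolding P_set_def using False by (auto simp: f_over_def)
    qed
    ultimately show ?thesis
      using P_num_conv[OF S n] O_num_conv[OF assms(2), of n] unfolding D_def by simp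
  qed
qed

end
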